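(* Let $k$ be an algebraically closed field of characteristic $0$. Let $A$ be the algebra of polynomial functions on an irreducible smooth affine variety $X\subset\mathbb{A}_k^n$, and let $\mathcal{D}_X$ be the Lie algebra of polynomial vector fields on $X$. As a $\mathcal{D}_X$-module, $A$ has a unique proper non-zero submodule, which is $1$-dimensional and consists of the constant functions.
   Context: $A = k[x_1,\ldots,x_n]/I$, where $I$ is the ideal of polynomials vanishing on $X$. $\mathcal{D}_X=\mathrm{Der}_k(A)$ is the Lie algebra of $k$-linear derivations of $A$ with the commutator bracket, and it acts on $A$ by derivations. Smooth means that $X$ has no singular points.
   Formalization: The formal theorem additionally assumes that X is not a single point; for a point A = k has no proper non-zero submodule, so the claim fails exactly in that case. *)

theory Defs
  imports
    "HOL-Algebra.Algebraic_Closure_Type"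
    "HOL-Analysis.Cartesian_Space"
    "HOL-Library.Poly_Mapping"
    "HOL-Library.Extended_Nat"
begin

unbundle no fps_syntax

section \<open>Lie algebras, their modules and submodules\<close>

text \<open>
  As in HOL-Algebra's theory of modules, a vector space is a \<open>module\<close> record. The bracket of
  a Lie algebra is stored in the \<open>mult\<close> field of that record (so \<open>mult\<close> is in general not
  associative); the field \<open>one\<close> carries no information.
\<close>

locale lie_algebra = Module.module K L
  for K :: "('k, 'r) ring_scheme" and L :: "('k, 'l, 's) module_scheme" +
  assumes bracket_closed:
      "x \<in> carrier L \<Longrightarrow> y \<in> carrier L \<Longrightarrow> x \<otimes>\<^bsub>L\<^esub> y \<in> carrier L"
    and bracket_add_left:
      "x \<in> carrier L \<Longrightarrow> y \<in> carrier L \<Longrightarrow> z \<in> carrier L \<Longrightarrow>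
        (x \<oplus>\<^bsub>L\<^esub> y) \<otimes>\<^bsub>L\<^esub> z = x \<otimes>\<^bsub>L\<^esub> z \<oplus>\<^bsub>L\<^esub> y \<otimes>\<^bsub>L\<^esub> z"
    and bracket_add_right:
      "x \<in> carrier L \<Longrightarrow> y \<in> carrier L \<Longrightarrow> z \<in> carrier L \<Longrightarrow>
        x \<otimes>\<^bsub>L\<^esub> (y \<oplus>\<^bsub>L\<^esub> z) = x \<otimes>\<^bsub>L\<^esub> y \<oplus>\<^bsub>L\<^esub> x \<otimes>\<^bsub>L\<^esub> z"
    and bracket_smult_left:
      "c \<in> carrier K \<Longrightarrow> x \<in> carrier L \<Longrightarrow> y \<in> carrier L \<Longrightarrow>
        (c \<odot>\<^bsub>L\<^esub> x) \<otimes>\<^bsub>L\<^esub> y = c \<odot>\<^bsub>L\<^esub> (x \<otimes>\<^bsub>L\<^esub> y)"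
    and bracket_smult_right:
      "c \<in> carrier K \<Longrightarrow> x \<in> carrier L \<Longrightarrow> y \<in> carrier L \<Longrightarrow>
        x \<otimes>\<^bsub>L\<^esub> (c \<odot>\<^bsub>L\<^esub> y) = c \<odot>\<^bsub>L\<^esub> (x \<otimes>\<^bsub>L\<^esub> y)"
    and bracket_self:
      "x \<in> carrier L \<Longrightarrow> x \<otimes>\<^bsub>L\<^esub> x = \<zero>\<^bsub>L\<^esub>"
    and jacobi:
      "x \<in> carrier L \<Longrightarrow> y \<in> carrier L \<Longrightarrow> z \<in> carrier L \<Longrightarrow>
        x \<otimes>\<^bsub>L\<^esub> (y \<otimes>\<^bsub>L\<^esub> z) \<oplus>\<^bsub>L\<^esub> y \<otimes>\<^bsub>L\<^esub> (z \<otimes>\<^bsub>L\<^esub> x) \<oplus>\<^bsub>L\<^esub> z \<otimes>\<^bsub>L\<^esub> (x \<otimes>\<^bsub>L\<^esub> y) = \<zero>\<^bsub>L\<^esub>"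

locale lie_module = lie_algebra K L + V: Module.module K V
  for K :: "('k, 'r) ring_scheme" and L :: "('k, 'l, 's) module_scheme"
    and V :: "('k, 'v, 't) module_scheme" +
  fixes act :: "'l \<Rightarrow> 'v \<Rightarrow> 'v"
  assumes act_closed:
      "x \<in> carrier L \<Longrightarrow> v \<in> carrier V \<Longrightarrow> act x v \<in> carrier V"
    and act_add_left:
      "x \<in> carrier L \<Longrightarrow> y \<in> carrier L \<Longrightarrow> v \<in> carrier V \<Longrightarrow>
        act (x \<oplus>\<^bsub>L\<^esub> y) v = act x v \<oplus>\<^bsub>V\<^esub> act y v"
    and act_smult_left:
      "c \<in> carrier K \<Longrightarrow> x \<in> carrier L \<Longrightarrow> v \<in> carrier V \<Longrightarrow>
        act (c \<odot>\<^bsub>L\<^esub> x) v = c \<odot>\<^bsub>V\<^esub> act x v"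
    and act_add_right:
      "x \<in> carrier L \<Longrightarrow> v \<in> carrier V \<Longrightarrow> w \<in> carrier V \<Longrightarrow>
        act x (v \<oplus>\<^bsub>V\<^esub> w) = act x v \<oplus>\<^bsub>V\<^esub> act x w"
    and act_smult_right:
      "c \<in> carrier K \<Longrightarrow> x \<in> carrier L \<Longrightarrow> v \<in> carrier V \<Longrightarrow>
        act x (c \<odot>\<^bsub>V\<^esub> v) = c \<odot>\<^bsub>V\<^esub> act x v"
    and act_bracket:
      "x \<in> carrier L \<Longrightarrow> y \<in> carrier L \<Longrightarrow> v \<in> carrier V \<Longrightarrow>
        act (x \<otimes>\<^bsub>L\<^esub> y) v = act x (act y v) \<ominus>\<^bsub>V\<^esub> act y (act x v)"

definition lie_submodule ::
  "('k, 'r) ring_scheme \<Rightarrow> ('k, 'l, 's) module_scheme \<Rightarrow> ('k, 'v, 't) module_scheme \<Rightarrow>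
    ('l \<Rightarrow> 'v \<Rightarrow> 'v) \<Rightarrow> 'v set \<Rightarrow> bool"
  where "lie_submodule K L V act N \<longleftrightarrow>
    submodule N K V \<and> (\<forall>x\<in>carrier L. \<forall>v\<in>N. act x v \<in> N)"


section \<open>The Lie algebra of derivations\<close>

text \<open>Derivations are extensional functions, so that they form an honest set of maps on the carrier.\<close>

definition derivations :: "('k, 'r) ring_scheme \<Rightarrow> ('k, 'a, 's) module_scheme \<Rightarrow> ('a \<Rightarrow> 'a) set"
  where "derivations K A =
    {D \<in> carrier A \<rightarrow>\<^sub>E carrier A.
      (\<forall>a\<in>carrier A. \<forall>b\<in>carrier A. D (a \<oplus>\<^bsub>A\<^esub> b) = D a \<oplus>\<^bsub>A\<^esub> D b) \<and>
      (\<forall>c\<in>carrier K. \<forall>a\<in>carrier A. D (c \<odot>\<^bsub>A\<^esub> a) = c \<odot>\<^bsub>A\<^esub> D a) \<and>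
      (\<forall>a\<in>carrier A. \<forall>b\<in>carrier A. D (a \<otimes>\<^bsub>A\<^esub> b) = D a \<otimes>\<^bsub>A\<^esub> b \<oplus>\<^bsub>A\<^esub> a \<otimes>\<^bsub>A\<^esub> D b)}"

definition derivation_algebra ::
  "('k, 'r) ring_scheme \<Rightarrow> ('k, 'a, 's) module_scheme \<Rightarrow> ('k, 'a \<Rightarrow> 'a) module"
  where "derivation_algebra K A =
    \<lparr>carrier = derivations K A,
     monoid.mult = (\<lambda>D E. \<lambda>a\<in>carrier A. D (E a) \<ominus>\<^bsub>A\<^esub> E (D a)),
     monoid.one = undefined,
     ring.zero = (\<lambda>a\<in>carrier A. \<zero>\<^bsub>A\<^esub>),
     ring.add = (\<lambda>D E. \<lambda>a\<in>carrier A. D a \<oplus>\<^bsub>A\<^esub> E a),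
     module.smult = (\<lambda>c D. \<lambda>a\<in>carrier A. c \<odot>\<^bsub>A\<^esub> D a)\<rparr>"


lemma mem_derivations_iff:
  "D \<in> derivations K A \<longleftrightarrow> D \<in> carrier A \<rightarrow>\<^sub>E carrier A \<and>
      (\<forall>a\<in>carrier A. \<forall>b\<in>carrier A. D (a \<oplus>\<^bsub>A\<^esub> b) = D a \<oplus>\<^bsub>A\<^esub> D b) \<and>
      (\<forall>c\<in>carrier K. \<forall>a\<in>carrier A. D (c \<odot>\<^bsub>A\<^esub> a) = c \<odot>\<^bsub>A\<^esub> D a) \<and>
      (\<forall>a\<in>carrier A. \<forall>b\<in>carrier A. D (a \<otimes>\<^bsub>A\<^esub> b) = D a \<otimes>\<^bsub>A\<^esub> b \<oplus>\<^bsub>A\<^esub> a \<otimes>\<^bsub>A\<^esub> D b)"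
  by (simp add: derivations_def)


lemma (in cring) bracket_leibniz_aux:
  assumes "x \<in> carrier R" "y \<in> carrier R" "u \<in> carrier R" "v \<in> carrier R"
    "x' \<in> carrier R" "y' \<in> carrier R" "u' \<in> carrier R" "v' \<in> carrier R" "a \<in> carrier R" "b \<in> carrier R"
  shows "((x \<otimes> b \<oplus> u \<otimes> v') \<oplus> (v \<otimes> u' \<oplus> a \<otimes> x')) \<ominus> ((y \<otimes> b \<oplus> v \<otimes> u') \<oplus> (u \<otimes> v' \<oplus> a \<otimes> y')) =
    (x \<ominus> y) \<otimes> b \<oplus> a \<otimes> (x' \<ominus> y')"
  using assms by algebra

lemma (in cring) sum_leibniz_aux:
  assumes "x \<in> carrier R" "y \<in> carrier R"
    "x' \<in> carrier R" "y' \<in> carrier R" "a \<in> carrier R" "b \<in> carrier R"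
  shows "(x \<otimes> b \<oplus> a \<otimes> x') \<oplus> (y \<otimes> b \<oplus> a \<otimes> y') = (x \<oplus> y) \<otimes> b \<oplus> a \<otimes> (x' \<oplus> y')"
  using assms by algebra

lemma (in cring) diff_add_aux:
  assumes "p \<in> carrier R" "q \<in> carrier R" "r \<in> carrier R" "s \<in> carrier R"
  shows "(p \<oplus> q) \<ominus> (r \<oplus> s) = (p \<ominus> r) \<oplus> (q \<ominus> s)"
    and "(p \<oplus> q) \<oplus> (r \<oplus> s) = (p \<oplus> r) \<oplus> (q \<oplus> s)"
  using assms by algebra+

lemma (in cring) jacobi_aux:
  assumes "xyz \<in> carrier R" "xzy \<in> carrier R" "yxz \<in> carrier R"
    "yzx \<in> carrier R" "zxy \<in> carrier R" "zyx \<in> carrier R"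
  shows "((xyz \<ominus> xzy) \<ominus> (yzx \<ominus> zyx)) \<oplus> ((yzx \<ominus> yxz) \<ominus> (zxy \<ominus> xzy)) \<oplus>
    ((zxy \<ominus> zyx) \<ominus> (xyz \<ominus> yxz)) = \<zero>"
  using assms by algebra

theorem lie_module_derivation_algebra:
  fixes K :: "('k, 'r) ring_scheme" and A :: "('k, 'a, 's) module_scheme"
  assumes "algebra K A"
  shows "lie_module K (derivation_algebra K A) A (\<lambda>D a. D a)"
proof -
  interpret algebra K A by fact
  have Acr: "cring A" by unfold_locales
  have cl: "D a \<in> carrier A" if "D \<in> derivations K A" "a \<in> carrier A" for D a
    using that by (auto simp: derivations_def)
  have ext: "D = E" if "D \<in> carrier A \<rightarrow>\<^sub>E carrier A" "E \<in> carrier A \<rightarrow>\<^sub>E carrier A"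
    "\<And>a. a \<in> carrier A \<Longrightarrow> D a = E a" for D E
    using that by (blast intro: PiE_ext)
  have dadd: "D (a \<oplus>\<^bsub>A\<^esub> b) = D a \<oplus>\<^bsub>A\<^esub> D b"
    if "D \<in> derivations K A" "a \<in> carrier A" "b \<in> carrier A" for D a b
    using that by (simp add: derivations_def)
  have dmult: "D (a \<otimes>\<^bsub>A\<^esub> b) = D a \<otimes>\<^bsub>A\<^esub> b \<oplus>\<^bsub>A\<^esub> a \<otimes>\<^bsub>A\<^esub> D b"
    if "D \<in> derivations K A" "a \<in> carrier A" "b \<in> carrier A" for D a b
    using that by (simp add: derivations_def)
  have dsmult: "D (c \<odot>\<^bsub>A\<^esub> a) = c \<odot>\<^bsub>A\<^esub> D a"
    if "D \<in> derivations K A" "c \<in> carrier K" "a \<in> carrier A" for D c a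
    using that by (simp add: derivations_def)
  have dz: "D \<zero>\<^bsub>A\<^esub> = \<zero>\<^bsub>A\<^esub>" if "D \<in> derivations K A" for D
  proof -
    have "D \<zero>\<^bsub>A\<^esub> \<oplus>\<^bsub>A\<^esub> D \<zero>\<^bsub>A\<^esub> = D \<zero>\<^bsub>A\<^esub>"
      using dadd[OF that M.zero_closed M.zero_closed] by simp
    thus ?thesis
      by (simp add: M.add.l_cancel_one cl that)
  qed
  have dneg: "D (\<ominus>\<^bsub>A\<^esub> a) = \<ominus>\<^bsub>A\<^esub> D a" if "D \<in> derivations K A" "a \<in> carrier A" for D a
    by (metis M.a_inv_closed M.add.inv_equality M.l_neg cl dadd dz that)
  have dminus: "D (a \<ominus>\<^bsub>A\<^esub> b) = D a \<ominus>\<^bsub>A\<^esub> D b"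
    if "D \<in> derivations K A" "a \<in> carrier A" "b \<in> carrier A" for D a b
    using that by (simp add: a_minus_def dadd dneg)
  have smneg: "c \<odot>\<^bsub>A\<^esub> (\<ominus>\<^bsub>A\<^esub> a) = \<ominus>\<^bsub>A\<^esub> (c \<odot>\<^bsub>A\<^esub> a)" if "c \<in> carrier K" "a \<in> carrier A" for c a
    using that by (simp add: smult_r_minus)
  have smm: "c \<odot>\<^bsub>A\<^esub> (a \<ominus>\<^bsub>A\<^esub> b) = c \<odot>\<^bsub>A\<^esub> a \<ominus>\<^bsub>A\<^esub> c \<odot>\<^bsub>A\<^esub> b"
    if "c \<in> carrier K" "a \<in> carrier A" "b \<in> carrier A" for c a b
    using that by (simp add: a_minus_def smult_r_distr smneg)
  note Asimps = cring.cring_simprules[OF Acr]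
  note aux = cring.bracket_leibniz_aux[OF Acr] cring.sum_leibniz_aux[OF Acr]
    cring.diff_add_aux[OF Acr] cring.jacobi_aux[OF Acr]
  have minus_closed: "a \<ominus>\<^bsub>A\<^esub> b \<in> carrier A" if "a \<in> carrier A" "b \<in> carrier A" for a b
    using that by (simp add: a_minus_def)
  have minus_self: "a \<ominus>\<^bsub>A\<^esub> a = \<zero>\<^bsub>A\<^esub>" if "a \<in> carrier A" for a
    using that by (simp add: a_minus_def M.r_neg)
  have multc: "a \<otimes>\<^bsub>A\<^esub> b \<in> carrier A" if "a \<in> carrier A" "b \<in> carrier A" for a b
    using that by (intro Asimps)
  have mcomm: "a \<otimes>\<^bsub>A\<^esub> b = b \<otimes>\<^bsub>A\<^esub> a" if "a \<in> carrier A" "b \<in> carrier A" for a b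
    using that by (intro comm_monoid.m_comm[OF cring.axioms(2)[OF Acr]])
  have comm3: "a \<otimes>\<^bsub>A\<^esub> (c \<odot>\<^bsub>A\<^esub> b) = c \<odot>\<^bsub>A\<^esub> (a \<otimes>\<^bsub>A\<^esub> b)"
    if "c \<in> carrier K" "a \<in> carrier A" "b \<in> carrier A" for c a b
    using smult_assoc2[of c b a] that by (simp add: mcomm)
  have comm4: "c \<odot>\<^bsub>A\<^esub> (d \<odot>\<^bsub>A\<^esub> b) = d \<odot>\<^bsub>A\<^esub> (c \<odot>\<^bsub>A\<^esub> b)"
    if "c \<in> carrier K" "d \<in> carrier K" "b \<in> carrier A" for c d b
    using that by (metis R.m_comm smult_assoc1)

  let ?br = "\<lambda>D E. \<lambda>a\<in>carrier A. D (E a) \<ominus>\<^bsub>A\<^esub> E (D a)"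
  let ?ad = "\<lambda>D E. \<lambda>a\<in>carrier A. D a \<oplus>\<^bsub>A\<^esub> E a"
  let ?sm = "\<lambda>c D. \<lambda>a\<in>carrier A. c \<odot>\<^bsub>A\<^esub> D a"
  let ?z = "\<lambda>a\<in>carrier A. \<zero>\<^bsub>A\<^esub>"
  have z: "?z \<in> derivations K A"
    by (auto simp: derivations_def smult_r_null)
  have br: "?br D E \<in> derivations K A" if "D \<in> derivations K A" "E \<in> derivations K A" for D E
    unfolding mem_derivations_iff
  proof (intro conjI ballI, goal_cases)
    case 1 then show ?case using that by (auto simp: cl minus_closed)
  next
    case (2 a b) then show ?case using that by (simp add: cl dadd aux(3))
  next
    case (3 a b) then show ?case using that by (simp add: cl dsmult smm)
  next
    case (4 a b) then show ?case using that by (simp add: cl dadd dmult multc aux(1))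
  qed
  have ad: "?ad D E \<in> derivations K A" if "D \<in> derivations K A" "E \<in> derivations K A" for D E
    unfolding mem_derivations_iff
  proof (intro conjI ballI, goal_cases)
    case 1 then show ?case using that by (auto simp: cl)
  next
    case (2 a b) then show ?case using that by (simp add: cl dadd aux(4))
  next
    case (3 a b) then show ?case using that by (simp add: cl dsmult smult_r_distr)
  next
    case (4 a b) then show ?case using that by (simp add: cl dmult multc aux(2))
  qed
  have sm: "?sm c D \<in> derivations K A" if "c \<in> carrier K" "D \<in> derivations K A" for c D
    unfolding mem_derivations_iff
    using that
    by (auto simp: cl dadd dmult dsmult smult_r_distr comm3 comm4 smult_assoc2 multc)
  have carr: "D \<in> carrier A \<rightarrow>\<^sub>E carrier A" if "D \<in> derivations K A" for D
    using that by (simp add: derivations_def)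
  have dext: "D = E" if "D \<in> derivations K A" "E \<in> derivations K A"
    "\<And>a. a \<in> carrier A \<Longrightarrow> D a = E a" for D E
    using ext carr that by blast
  let ?L = "derivation_algebra K A"
  have L: "carrier ?L = derivations K A" "x \<otimes>\<^bsub>?L\<^esub> y = ?br x y" "x \<oplus>\<^bsub>?L\<^esub> y = ?ad x y"
    "c \<odot>\<^bsub>?L\<^esub> x = ?sm c x" "\<zero>\<^bsub>?L\<^esub> = ?z" for x y c
    by (simp_all add: derivation_algebra_def)
  have ag: "abelian_group ?L"
  proof (rule abelian_groupI)
    fix x assume x: "x \<in> carrier ?L"
    have one: "\<ominus>\<^bsub>K\<^esub> \<one>\<^bsub>K\<^esub> \<in> carrier K" by simp
    show "\<exists>y\<in>carrier ?L. y \<oplus>\<^bsub>?L\<^esub> x = \<zero>\<^bsub>?L\<^esub>"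
    proof (rule bexI)
      show "?sm (\<ominus>\<^bsub>K\<^esub> \<one>\<^bsub>K\<^esub>) x \<in> carrier ?L" using sm[OF one] x by (simp add: L)
      show "?sm (\<ominus>\<^bsub>K\<^esub> \<one>\<^bsub>K\<^esub>) x \<oplus>\<^bsub>?L\<^esub> x = \<zero>\<^bsub>?L\<^esub>"
        using x by (auto simp: L cl smult_l_minus M.l_neg fun_eq_iff)
    qed
    show "\<zero>\<^bsub>?L\<^esub> \<oplus>\<^bsub>?L\<^esub> x = x"
      using x unfolding L by (intro dext[OF ad[OF z]]) (simp_all add: cl)
  next
    fix x y u assume "x \<in> carrier ?L" "y \<in> carrier ?L" "u \<in> carrier ?L"
    thus "(x \<oplus>\<^bsub>?L\<^esub> y) \<oplus>\<^bsub>?L\<^esub> u = x \<oplus>\<^bsub>?L\<^esub> (y \<oplus>\<^bsub>?L\<^esub> u)"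
      unfolding L by (intro restrict_ext) (simp add: cl M.a_assoc)
  next
    fix x y assume "x \<in> carrier ?L" "y \<in> carrier ?L"
    thus "x \<oplus>\<^bsub>?L\<^esub> y = y \<oplus>\<^bsub>?L\<^esub> x"
      unfolding L by (intro restrict_ext) (simp add: cl M.a_comm)
  qed (unfold L, simp_all add: ad z)
  have mod: "Module.module K ?L"
  proof (rule moduleI)
    show "cring K" by unfold_locales
    show "abelian_group ?L" by (rule ag)
    show "\<one>\<^bsub>K\<^esub> \<odot>\<^bsub>?L\<^esub> x = x" if "x \<in> carrier ?L" for x
      using that unfolding L by (intro dext[OF sm]) (simp_all add: cl)
  qed (unfold L, simp_all add: sm, (intro restrict_ext, simp add: cl smult_l_distr smult_r_distr smult_assoc1)+)
  show ?thesis
  proof (intro lie_module.intro lie_algebra.intro lie_algebra_axioms.intro mod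
      lie_module_axioms.intro)
    show "Module.module K A" by (rule module_axioms)
  qed (unfold L, simp_all add: br ad sm cl dadd dsmult dminus smm smult_r_distr minus_self aux minus_closed
        cong: restrict_cong)
qed


section \<open>Polynomials and affine varieties\<close>

text \<open>
  Polynomials over \<open>'k\<close> in variables indexed by the finite type \<open>'n\<close>; a monomial is its
  exponent vector. Affine \<open>n\<close>-space over \<open>'k\<close> is \<open>'k ^ 'n\<close>.
\<close>

type_synonym ('n, 'k) mpoly = "('n \<Rightarrow>\<^sub>0 nat) \<Rightarrow>\<^sub>0 'k"

abbreviation const_poly :: "'k::comm_ring_1 \<Rightarrow> ('n, 'k) mpoly"
  where "const_poly c \<equiv> Poly_Mapping.single 0 c"

definition eval_mpoly :: "('n::finite, 'k::comm_ring_1) mpoly \<Rightarrow> 'k ^ 'n \<Rightarrow> 'k"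
  where "eval_mpoly f x =
    (\<Sum>m\<in>Poly_Mapping.keys f. Poly_Mapping.lookup f m * (\<Prod>i\<in>UNIV. x $ i ^ Poly_Mapping.lookup m i))"

text \<open>The truncated subtraction of exponents is harmless: for exponent \<open>0\<close> the coefficient vanishes.\<close>

definition partial_deriv :: "'n \<Rightarrow> ('n::finite, 'k::comm_ring_1) mpoly \<Rightarrow> ('n, 'k) mpoly"
  where "partial_deriv i f =
    (\<Sum>m\<in>Poly_Mapping.keys f.
      Poly_Mapping.single (m - Poly_Mapping.single i 1)
        (of_nat (Poly_Mapping.lookup m i) * Poly_Mapping.lookup f m))"

definition zero_locus :: "('n::finite, 'k::comm_ring_1) mpoly set \<Rightarrow> ('k ^ 'n) set"
  where "zero_locus S = {x. \<forall>f\<in>S. eval_mpoly f x = 0}"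

definition vanishing_ideal :: "('k::comm_ring_1 ^ 'n::finite) set \<Rightarrow> ('n, 'k) mpoly set"
  where "vanishing_ideal V = {f. \<forall>x\<in>V. eval_mpoly f x = 0}"

definition zariski_closed :: "('k::comm_ring_1 ^ 'n::finite) set \<Rightarrow> bool"
  where "zariski_closed V \<longleftrightarrow> (\<exists>S. V = zero_locus S)"

definition irreducible_affine_variety :: "('k::comm_ring_1 ^ 'n::finite) set \<Rightarrow> bool"
  where "irreducible_affine_variety V \<longleftrightarrow>
    zariski_closed V \<and> V \<noteq> {} \<and>
    (\<forall>Y Z. zariski_closed Y \<longrightarrow> zariski_closed Z \<longrightarrow> V = Y \<union> Z \<longrightarrow> V = Y \<or> V = Z)"

text \<open>
  Krull dimension of \<open>V\<close>: the supremum of the lengths of strict chains of irreducible closed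
  subsets of \<open>V\<close>. For closed \<open>V\<close>, the closed subsets of the subspace \<open>V\<close> are exactly the closed
  subsets of affine space contained in \<open>V\<close>.
\<close>

definition variety_dim :: "('k::comm_ring_1 ^ 'n::finite) set \<Rightarrow> enat"
  where "variety_dim V =
    Sup {enat m | m. \<exists>Z :: nat \<Rightarrow> ('k ^ 'n) set.
      (\<forall>i\<le>m. irreducible_affine_variety (Z i) \<and> Z i \<subseteq> V) \<and> (\<forall>i<m. Z i \<subset> Z (Suc i))}"

definition tangent_space :: "('k::field ^ 'n::finite) set \<Rightarrow> 'k ^ 'n \<Rightarrow> ('k ^ 'n) set"
  where "tangent_space V p =
    {v. \<forall>f\<in>vanishing_ideal V. (\<Sum>i\<in>UNIV. eval_mpoly (partial_deriv i f) p * v $ i) = 0}"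

definition singular_point :: "('k::field ^ 'n::finite) set \<Rightarrow> 'k ^ 'n \<Rightarrow> bool"
  where "singular_point V p \<longleftrightarrow> p \<in> V \<and> enat (vec.dim (tangent_space V p)) \<noteq> variety_dim V"

definition smooth_variety :: "('k::field ^ 'n::finite) set \<Rightarrow> bool"
  where "smooth_variety V \<longleftrightarrow> (\<nexists>p. singular_point V p)"


section \<open>Polynomial functions and vector fields on a variety\<close>

abbreviation ground_field :: "'k::field ring"
  where "ground_field \<equiv> ring_of_type_algebra"

abbreviation polynomial_ring :: "('n::finite, 'k::field) mpoly ring"
  where "polynomial_ring \<equiv> ring_of_type_algebra"

definition function_class :: "('k::field ^ 'n::finite) set \<Rightarrow> ('n, 'k) mpoly \<Rightarrow> ('n, 'k) mpoly set"
  where "function_class V f = vanishing_ideal V +>\<^bsub>polynomial_ring\<^esub> f"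

definition coordinate_algebra :: "('k::field ^ 'n::finite) set \<Rightarrow> ('k, ('n, 'k) mpoly set) module"
  where "coordinate_algebra V =
    (let Q = polynomial_ring Quot vanishing_ideal V in
     \<lparr>carrier = carrier Q, monoid.mult = monoid.mult Q, monoid.one = monoid.one Q,
      ring.zero = ring.zero Q, ring.add = ring.add Q,
      module.smult = (\<lambda>c a. function_class V (const_poly c) \<otimes>\<^bsub>Q\<^esub> a)\<rparr>)"

lemma eval_mpoly_add: "eval_mpoly (f + g) x = eval_mpoly f x + eval_mpoly g x"
  unfolding eval_mpoly_def
  by (rule setsum_keys_plus_distrib) (simp_all add: algebra_simps)

lemma eval_mpoly_single:
  "eval_mpoly (Poly_Mapping.single m c) x = c * (\<Prod>i\<in>UNIV. x $ i ^ Poly_Mapping.lookup m i)"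
  by (cases "c = 0") (simp_all add: eval_mpoly_def)

lemma eval_mpoly_zero [simp]: "eval_mpoly 0 x = 0"
  by (simp add: eval_mpoly_def)

lemma mpoly_induct [case_names zero add]:
  assumes "P 0" and step: "\<And>f m c. P f \<Longrightarrow> P (f + Poly_Mapping.single m c)"
  shows "P (f :: ('n, 'k::comm_ring_1) mpoly)"
proof (induction f rule: Poly_Mapping.update_induct)
  case (update f a b)
  have "Poly_Mapping.update a b f = f + Poly_Mapping.single a b"
    using update by (intro poly_mapping_eqI)
      (auto simp: lookup_update lookup_add lookup_single when_def in_keys_iff)
  thus ?case using step[OF update(3)] by simp
qed (fact assms(1))

lemma eval_mpoly_mult: "eval_mpoly (f * g) x = eval_mpoly f x * eval_mpoly g x"
proof (induction f rule: mpoly_induct)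
  case (add f m c)
  have "eval_mpoly (Poly_Mapping.single m c * g) x = eval_mpoly (Poly_Mapping.single m c) x * eval_mpoly g x"
  proof (induction g rule: mpoly_induct)
    case (add g m' c')
    thus ?case
      by (simp add: distrib_left eval_mpoly_add mult_single eval_mpoly_single lookup_add power_add
          prod.distrib algebra_simps)
  qed simp
  with add show ?case by (simp add: distrib_right eval_mpoly_add)
qed simp

lemma eval_mpoly_uminus: "eval_mpoly (- f) x = - eval_mpoly f x"
  using eval_mpoly_add[of f "- f" x] by (simp add: eq_neg_iff_add_eq_0 add.commute)

lemma ideal_vanishing_ideal:
  fixes V :: "('k::field ^ 'n::finite) set"
  shows "ideal (vanishing_ideal V) polynomial_ring"
proof -
  interpret P: cring "polynomial_ring :: ('n, 'k) mpoly ring"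
    by (rule cring_from_type_algebra)
  have neg: "\<ominus>\<^bsub>polynomial_ring\<^esub> f = - f" for f :: "('n, 'k) mpoly"
    by (rule P.add.inv_equality) (simp_all add: ring_of_type_algebra_def)
  show ?thesis
  proof (rule idealI)
    show "subgroup (vanishing_ideal V) (add_monoid polynomial_ring)"
      using neg[unfolded a_inv_def]
      by (intro subgroup.intro) (simp_all add: vanishing_ideal_def eval_mpoly_add eval_mpoly_uminus, 
         simp_all add: ring_of_type_algebra_def eval_mpoly_add)
  qed (unfold_locales, auto simp: ring_of_type_algebra_def vanishing_ideal_def eval_mpoly_mult)
qed

lemma cring_polynomial_ring: "cring (polynomial_ring :: ('n::finite, 'k::field) mpoly ring)"
  by (rule cring_from_type_algebra)

theorem algebra_coordinate_algebra:
  fixes V :: "('k::field ^ 'n::finite) set"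
  shows "algebra ground_field (coordinate_algebra V)"
proof -
  let ?P = "polynomial_ring :: ('n, 'k) mpoly ring"
  let ?Q = "?P Quot vanishing_ideal V"
  interpret I: ideal "vanishing_ideal V" ?P by (rule ideal_vanishing_ideal)
  interpret Q: cring ?Q by (intro I.quotient_is_cring cring_polynomial_ring)
  interpret h: ring_hom_ring ?P ?Q "(+>\<^bsub>?P\<^esub>) (vanishing_ideal V)"
    by (rule I.rcos_ring_hom_ring)
  have P: "carrier ?P = UNIV" "\<And>f g. f \<oplus>\<^bsub>?P\<^esub> g = f + g" "\<And>f g. f \<otimes>\<^bsub>?P\<^esub> g = f * g"
    "\<one>\<^bsub>?P\<^esub> = 1"
    by (simp_all add: ring_of_type_algebra_def)
  have A: "carrier (coordinate_algebra V) = carrier ?Q"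
    "a \<otimes>\<^bsub>coordinate_algebra V\<^esub> b = a \<otimes>\<^bsub>?Q\<^esub> b" "\<one>\<^bsub>coordinate_algebra V\<^esub> = \<one>\<^bsub>?Q\<^esub>"
    "a \<oplus>\<^bsub>coordinate_algebra V\<^esub> b = a \<oplus>\<^bsub>?Q\<^esub> b" "\<zero>\<^bsub>coordinate_algebra V\<^esub> = \<zero>\<^bsub>?Q\<^esub>"
    "c \<odot>\<^bsub>coordinate_algebra V\<^esub> a = function_class V (const_poly c) \<otimes>\<^bsub>?Q\<^esub> a" for a b c
    by (simp_all add: coordinate_algebra_def Let_def)
  have fc: "function_class V f \<in> carrier ?Q"
    "function_class V (f + g) = function_class V f \<oplus>\<^bsub>?Q\<^esub> function_class V g"
    "function_class V (f * g) = function_class V f \<otimes>\<^bsub>?Q\<^esub> function_class V g"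
    "function_class V 1 = \<one>\<^bsub>?Q\<^esub>" for f g
    using h.hom_closed[of f] h.hom_add[of f g] h.hom_mult[of f g] h.hom_one
    by (simp_all add: function_class_def P)
  have K: "carrier (ground_field :: 'k ring) = UNIV" "\<And>c d :: 'k. c \<oplus>\<^bsub>ground_field\<^esub> d = c + d"
    "\<And>c d :: 'k. c \<otimes>\<^bsub>ground_field\<^esub> d = c * d" "\<one>\<^bsub>ground_field\<^esub> = (1::'k)"
    by (simp_all add: ring_of_type_algebra_def)
  have s1: "const_poly (c * d) = (const_poly c * const_poly d :: ('n, 'k) mpoly)" for c d
    by (simp add: mult_single)
  have cr: "cring (coordinate_algebra V)"
  proof (intro cringI abelian_groupI comm_monoidI)
    fix x assume "x \<in> carrier (coordinate_algebra V)"
    thus "\<exists>y\<in>carrier (coordinate_algebra V). y \<oplus>\<^bsub>coordinate_algebra V\<^esub> x = \<zero>\<^bsub>coordinate_algebra V\<^esub>"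
      unfolding A by (intro bexI[of _ "\<ominus>\<^bsub>?Q\<^esub> x"] Q.l_neg Q.a_inv_closed)
  qed (simp_all add: A Q.a_assoc Q.m_assoc Q.m_comm Q.a_comm Q.a_lcomm Q.m_lcomm Q.l_distr Q.r_distr)
  show ?thesis
  proof (rule algebraI)
    show "cring (ground_field :: 'k ring)" by (rule cring_from_type_algebra)
    show "cring (coordinate_algebra V)" by (rule cr)
  qed (unfold A K, auto simp: fc s1 single_add Q.l_distr Q.r_distr Q.m_assoc)
qed

definition vector_fields ::
  "('k::field ^ 'n::finite) set \<Rightarrow> ('k, ('n, 'k) mpoly set \<Rightarrow> ('n, 'k) mpoly set) module"
  where "vector_fields V = derivation_algebra ground_field (coordinate_algebra V)"

corollary lie_module_coordinate_algebra:
  "lie_module ground_field (vector_fields V) (coordinate_algebra V) (\<lambda>D f. D f)"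
  unfolding vector_fields_def
  by (intro lie_module_derivation_algebra algebra_coordinate_algebra)

definition constant_functions :: "('k::field ^ 'n::finite) set \<Rightarrow> ('n, 'k) mpoly set set"
  where "constant_functions V = {function_class V (const_poly c) | c. True}"

definition vector_field_submodule ::
  "('k::field ^ 'n::finite) set \<Rightarrow> ('n, 'k) mpoly set set \<Rightarrow> bool"
  where "vector_field_submodule V N \<longleftrightarrow>
    lie_submodule ground_field (vector_fields V) (coordinate_algebra V) (\<lambda>D f. D f) N"

text \<open>
  HOL-Algebra measures the dimension of a subset of a ring over a subfield of that ring; the
  subfield here is the copy of the base field \<open>K\<close> in the \<open>K\<close>-algebra \<open>A\<close>.
\<close>

definition has_dimension ::
  "('k, 'r) ring_scheme \<Rightarrow> ('k, 'a, 's) module_scheme \<Rightarrow> nat \<Rightarrow> 'a set \<Rightarrow> bool"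
  where "has_dimension K A d N \<longleftrightarrow>
    ring.dimension A d ((\<lambda>c. c \<odot>\<^bsub>A\<^esub> \<one>\<^bsub>A\<^esub>) ` carrier K) N"

end

theory Submission
  imports Defs "HOL-Analysis.Determinants"
begin

text \<open>
  Let \<open>N\<close> be a submodule containing a nonconstant function \<open>f\<close>, and let \<open>I\<close> be the largest ideal of
  \<open>A\<close> inside \<open>N\<close>; it is stable under all vector fields. As \<open>g u\<close> is a vector field whenever \<open>u\<close> is,
  \<open>I\<close> contains \<open>u(f)\<close> for every vector field \<open>u\<close>. If \<open>1 \<notin> I\<close>, then \<open>I\<close> has a zero \<open>p \<in> V\<close> by the
  Nullstellensatz. But a stable ideal that vanishes at a point \<open>p\<close> is zero: near \<open>p\<close> there are local
  parameters \<open>x\<^sub>k\<close>, \<open>k \<in> T\<close>, and, for some \<open>h\<close> with \<open>h(p) \<noteq> 0\<close>, global vector fields equal to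
  \<open>h \<partial>/\<partial>x\<^sub>k\<close>. Every nonzero ideal contains a nonzero polynomial in the \<open>x\<^sub>k\<close>, over which all functions
  are algebraic, and repeated differentiation turns it into a nonzero constant, up to powers of \<open>h\<close>;
  so a nonzero stable ideal contains a power of \<open>h\<close>. Hence \<open>I = 0\<close>, so all vector fields
  kill \<open>f\<close>, and the ideal generated by \<open>f - f(p)\<close> is stable and vanishes at \<open>p\<close>. So it is zero too, and
  \<open>f\<close> is constant, a contradiction.
\<close>

section \<open>Ideals, and algebraic elements modulo a prime\<close>

locale ring_ideal =
  fixes I :: "'a::comm_ring_1 set"
  assumes zero_mem: "0 \<in> I"
    and add_mem: "a \<in> I \<Longrightarrow> b \<in> I \<Longrightarrow> a + b \<in> I"
    and mult_mem: "b \<in> I \<Longrightarrow> a * b \<in> I"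
begin

lemma mult_mem_right: "a \<in> I \<Longrightarrow> a * b \<in> I"
  using mult_mem[of a b] by (simp add: mult.commute)

lemma uminus_mem: "a \<in> I \<Longrightarrow> - a \<in> I"
  using mult_mem[of a "- 1"] by simp

lemma diff_mem: "a \<in> I \<Longrightarrow> b \<in> I \<Longrightarrow> a - b \<in> I"
  using add_mem[of a "- b"] uminus_mem by simp

lemma sum_mem: "(\<And>x. x \<in> A \<Longrightarrow> f x \<in> I) \<Longrightarrow> sum f A \<in> I"
  by (induction A rule: infinite_finite_induct) (auto intro: zero_mem add_mem)

lemma mem_add_cancel: "a \<in> I \<Longrightarrow> a + b \<in> I \<longleftrightarrow> b \<in> I"
  using add_mem diff_mem by (metis add_diff_cancel_left')

lemma poly_mem: "(\<And>k. coeff q k \<in> I) \<Longrightarrow> poly q x \<in> I"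
  unfolding poly_altdef by (intro sum_mem mult_mem_right)

end

locale ring_prime_ideal = ring_ideal +
  assumes one_notin: "1 \<notin> I"
    and prime: "a * b \<in> I \<Longrightarrow> a \<in> I \<or> b \<in> I"
begin

lemma power_mem: "a ^ k \<in> I \<Longrightarrow> a \<in> I"
  by (induction k) (use one_notin prime in auto)

end

section \<open>Polynomials with coefficients in a subring, and pseudo-division\<close>

locale unital_subring =
  fixes B :: "'a::comm_ring_1 set"
  assumes one_closed: "1 \<in> B"
    and diff_closed: "a \<in> B \<Longrightarrow> b \<in> B \<Longrightarrow> a - b \<in> B"
    and mult_closed: "a \<in> B \<Longrightarrow> b \<in> B \<Longrightarrow> a * b \<in> B"
begin

lemma zero_closed: "0 \<in> B"
  using diff_closed[OF one_closed one_closed] by simp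

lemma add_closed: "a \<in> B \<Longrightarrow> b \<in> B \<Longrightarrow> a + b \<in> B"
  using diff_closed[of a "0 - b"] diff_closed[OF zero_closed, of b] by simp

lemma power_closed: "a \<in> B \<Longrightarrow> a ^ k \<in> B"
  by (induction k) (auto intro: one_closed mult_closed)

lemma sum_closed: "(\<And>x. x \<in> A \<Longrightarrow> f x \<in> B) \<Longrightarrow> sum f A \<in> B"
  by (induction A rule: infinite_finite_induct) (auto intro: zero_closed add_closed)

lemma of_nat_closed: "of_nat n \<in> B"
  by (induction n) (auto intro: zero_closed one_closed add_closed)

text \<open>The subring is a set and not a type, so polynomials over it are singled out among those
  over the whole ring.\<close>

definition polys :: "'a poly set"
  where "polys = {q. \<forall>k. coeff q k \<in> B}"

lemma coeff_polys: "q \<in> polys \<Longrightarrow> coeff q k \<in> B"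
  by (simp add: polys_def)

lemma polys_add: "p \<in> polys \<Longrightarrow> q \<in> polys \<Longrightarrow> p + q \<in> polys"
  by (simp add: polys_def add_closed)

lemma polys_diff: "p \<in> polys \<Longrightarrow> q \<in> polys \<Longrightarrow> p - q \<in> polys"
  by (simp add: polys_def diff_closed)

lemma polys_mult: "p \<in> polys \<Longrightarrow> q \<in> polys \<Longrightarrow> p * q \<in> polys"
  by (simp add: polys_def coeff_mult sum_closed mult_closed)

lemma polys_smult: "a \<in> B \<Longrightarrow> q \<in> polys \<Longrightarrow> smult a q \<in> polys"
  by (simp add: polys_def mult_closed)

lemma polys_monom: "a \<in> B \<Longrightarrow> Polynomial.monom a k \<in> polys"
  by (simp add: polys_def zero_closed)

lemma polys_zero: "0 \<in> polys"
  by (simp add: polys_def zero_closed)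

text \<open>Leading coefficients cannot be inverted, so each round multiplies by that of
  \<open>m\<close> before cancelling the top term of \<open>q\<close>. The bound on
  \<open>degree s\<close> later shows that a quotient has lower degree than the polynomial
  divided.\<close>

lemma pseudo_division:
  assumes m: "m \<in> polys" "degree m > 0" and q: "q \<in> polys"
  shows "\<exists>k s r. s \<in> polys \<and> r \<in> polys \<and> smult (lead_coeff m ^ k) q = s * m + r \<and>
    degree r < degree m \<and> degree s \<le> degree q - degree m"
  using q
proof (induction "degree q" arbitrary: q rule: less_induct)
  case less
  let ?a = "lead_coeff m"
  show ?case
  proof (cases "degree q < degree m")
    case True
    thus ?thesis using less.prems
      by (intro exI[of _ 0] exI[of _ "0::'a poly"] exI[of _ q]) (simp add: polys_zero)
  next
    case False
    let ?t = "Polynomial.monom (lead_coeff q) (degree q - degree m)"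
    let ?q = "smult ?a q - ?t * m"
    have t: "?t \<in> polys"
      using less.prems by (intro polys_monom coeff_polys)
    have q': "?q \<in> polys"
      using less.prems m t by (intro polys_diff polys_smult polys_mult) (auto simp: coeff_polys)
    have "degree ?t \<le> degree q - degree m"
      by (rule degree_monom_le)
    hence "degree (?t * m) \<le> degree q"
      using degree_mult_le[of ?t m] False by linarith
    hence "degree ?q \<le> degree q"
      by (meson degree_diff_le degree_smult_le)
    moreover have "coeff ?q (degree q) = 0"
      using False by (simp add: coeff_monom_mult)
    \<comment> \<open>This excludes degree 0, where losing the top coefficient would not lower the
      degree.\<close>
    moreover have "degree q > 0" using False m by simp
    ultimately have lt: "degree ?q < degree q"
      by (metis leading_coeff_0_iff le_neq_implies_less degree_0)
    from less.hyps[OF this q'] obtain k s r where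
      *: "s \<in> polys" "r \<in> polys" "smult (?a ^ k) ?q = s * m + r" "degree r < degree m"
        "degree s \<le> degree ?q - degree m" by blast
    let ?s = "smult (?a ^ k) ?t + s"
    have "degree ?s \<le> degree q - degree m"
      using degree_smult_le[of "?a ^ k" ?t] \<open>degree ?t \<le> _\<close> *(5) lt
      by (intro degree_add_le) auto
    moreover have "smult (?a ^ Suc k) q = ?s * m + r"
      using *(3) by (simp add: smult_diff_right algebra_simps)
    moreover have "?s \<in> polys"
      using * m t by (intro polys_add polys_smult power_closed) (auto simp: coeff_polys)
    ultimately show ?thesis using * by blast
  qed
qed

end

section \<open>Algebraic elements modulo a prime ideal\<close>

locale subring_mod_prime = unital_subring B + ring_prime_ideal P
  for B P :: "'a::comm_ring_1 set"
begin

text \<open>The residue class of \<open>x\<close> modulo \<open>P\<close> is algebraic over the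
  image of \<open>B\<close>. Working with representatives avoids the quotient ring and its fraction
  field.\<close>

definition algebraic_mod :: "'a \<Rightarrow> bool"
  where "algebraic_mod x \<longleftrightarrow> (\<exists>q\<in>polys. poly q x \<in> P \<and> (\<exists>k. coeff q k \<notin> P))"

text \<open>This is the minimal polynomial over the fraction field of the image of \<open>B\<close>,
  with denominators cleared: its leading coefficient is only nonzero modulo
  \<open>P\<close>.\<close>

definition minimal_poly_mod :: "'a \<Rightarrow> 'a poly \<Rightarrow> bool"
  where "minimal_poly_mod x m \<longleftrightarrow> m \<in> polys \<and> poly m x \<in> P \<and> lead_coeff m \<notin> P \<and> degree m > 0 \<and>
    (\<forall>q\<in>polys. degree q < degree m \<longrightarrow> poly q x \<in> P \<longrightarrow> (\<forall>k. coeff q k \<in> P))"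

text \<open>A leading coefficient in \<open>P\<close> is invisible modulo \<open>P\<close>, so
  removing its term lowers the degree and changes nothing else modulo \<open>P\<close>.\<close>

lemma drop_lead_coeff:
  assumes "q \<in> polys" "lead_coeff q \<in> P" "degree q > 0"
  defines "q' \<equiv> q - Polynomial.monom (lead_coeff q) (degree q)"
  shows "q' \<in> polys" "degree q' < degree q" "coeff q k - coeff q' k \<in> P" "poly q x - poly q' x \<in> P"
proof -
  show "q' \<in> polys"
    unfolding q'_def using assms by (intro polys_diff polys_monom coeff_polys)
  have "degree q' \<le> degree q"
    unfolding q'_def by (intro degree_diff_le) (auto simp: degree_monom_le)
  moreover have "coeff q' (degree q) = 0"
    by (simp add: q'_def)
  ultimately show "degree q' < degree q"
    using assms(3) by (metis leading_coeff_0_iff le_neq_implies_less degree_0)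
  show "coeff q k - coeff q' k \<in> P"
    using assms(2) by (auto simp: q'_def zero_mem)
  show "poly q x - poly q' x \<in> P"
    using assms(2) by (auto simp: q'_def poly_monom intro: mult_mem_right)
qed

lemma mem_cong: "a - b \<in> P \<Longrightarrow> a \<in> P \<longleftrightarrow> b \<in> P"
  using mem_add_cancel[of "a - b" b] by simp

text \<open>Among the annihilating polynomials that are nonzero modulo \<open>P\<close>, one of
  least degree works: a leading coefficient in \<open>P\<close> could be dropped, and a constant
  would have its own value in \<open>P\<close>.\<close>

lemma ex_minimal_poly_mod:
  assumes "algebraic_mod x"
  shows "\<exists>m. minimal_poly_mod x m"
proof -
  let ?Q = "\<lambda>q. q \<in> polys \<and> poly q x \<in> P \<and> (\<exists>k. coeff q k \<notin> P)"
  obtain q where "?Q q" using assms by (auto simp: algebraic_mod_def)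
  then obtain m where m: "?Q m" and min: "\<And>q. ?Q q \<Longrightarrow> degree m \<le> degree q"
    using ex_has_least_nat[of ?Q q degree] by blast
  have lead: "lead_coeff m \<notin> P"
  proof
    assume l: "lead_coeff m \<in> P"
    show False
    proof (cases "degree m = 0")
      case True
      thus False using m l by (metis coeff_eq_0 zero_mem gr0I)
    next
      case False
      note d = drop_lead_coeff[of m, OF _ l]
      have "?Q (m - Polynomial.monom (lead_coeff m) (degree m))"
        using d m False mem_cong by blast
      from min[OF this] d(2) m False show False by force
    qed
  qed
  have "degree m > 0"
  proof (rule ccontr)
    assume "\<not> degree m > 0"
    hence "poly m x = lead_coeff m" by (auto elim!: degree_eq_zeroE)
    thus False using m lead by simp
  qed
  moreover have "\<forall>k. coeff q k \<in> P" if "q \<in> polys" "degree q < degree m" "poly q x \<in> P" for q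
    using min[of q] that by force
  ultimately show ?thesis
    using m lead by (auto simp: minimal_poly_mod_def)
qed

text \<open>The remainder of the pseudo-division also kills \<open>x\<close> modulo
  \<open>P\<close>, and its degree is too small unless all its coefficients lie in
  \<open>P\<close>.\<close>

lemma minimal_poly_mod_division:
  assumes m: "minimal_poly_mod x m" and q: "q \<in> polys" "poly q x \<in> P"
  obtains k s r where "s \<in> polys" "r \<in> polys" "smult (lead_coeff m ^ k) q = s * m + r"
    "\<And>k. coeff r k \<in> P"
proof -
  obtain k s r where *: "s \<in> polys" "r \<in> polys" "smult (lead_coeff m ^ k) q = s * m + r"
    "degree r < degree m"
    using pseudo_division[of m q] m q(1) by (auto simp: minimal_poly_mod_def)
  have "poly r x = lead_coeff m ^ k * poly q x - poly s x * poly m x"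
    using arg_cong[OF *(3), of "\<lambda>p. poly p x"] by (simp add: algebra_simps)
  also have "\<dots> \<in> P"
    using m q(2) by (auto simp: minimal_poly_mod_def intro: diff_mem mult_mem)
  finally show ?thesis
    using that[OF *(1-3)] m *(2,4) by (auto simp: minimal_poly_mod_def)
qed

text \<open>Euclid's algorithm: modulo \<open>P\<close>, the minimal polynomial has no nontrivial divisor.\<close>

lemma algebraic_multiple_in_subring:
  assumes "algebraic_mod x" and q: "q \<in> polys" "poly q x \<notin> P"
  shows "\<exists>u\<in>polys. \<exists>b\<in>B. b \<notin> P \<and> poly u x * poly q x - b \<in> P"
proof -
  obtain m where mm: "minimal_poly_mod x m"
    using ex_minimal_poly_mod assms by blast
  hence m: "m \<in> polys" "poly m x \<in> P" "lead_coeff m \<notin> P" "degree m > 0"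
    by (auto simp: minimal_poly_mod_def)
  \<comment> \<open>The value of a candidate \<open>s\<close> is, modulo \<open>P\<close>, a nonzero
    multiple of \<open>poly q x\<close>. A candidate of least degree will turn out to be constant,
    which gives the element of \<open>B\<close>.\<close>
  let ?Q = "\<lambda>s. s \<in> polys \<and> poly s x \<notin> P \<and> (\<exists>u\<in>polys. poly u x * poly q x - poly s x \<in> P)"
  have "?Q q"
    using q polys_monom[OF one_closed, of 0]
    by (auto intro!: bexI[of _ "Polynomial.monom 1 0"] simp: zero_mem poly_monom)
  then obtain s where s: "?Q s" and min: "\<And>s'. ?Q s' \<Longrightarrow> degree s \<le> degree s'"
    using ex_has_least_nat[of ?Q q degree] by blast
  from s obtain u where u: "u \<in> polys" "poly u x * poly q x - poly s x \<in> P" by blast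
  have multiple: "?Q r" if "r \<in> polys" "poly r x \<notin> P" "t \<in> polys" "poly t x * poly s x - poly r x \<in> P"
    for r t
  proof -
    have "poly (t * u) x * poly q x - poly r x =
      poly t x * (poly u x * poly q x - poly s x) + (poly t x * poly s x - poly r x)"
      by (simp add: algebra_simps)
    also have "\<dots> \<in> P"
      using that u by (intro add_mem mult_mem)
    finally show ?thesis
      using that u by (auto intro!: bexI[of _ "t * u"] polys_mult)
  qed
  have lead: "lead_coeff s \<notin> P" if "degree s > 0"
  proof
    assume l: "lead_coeff s \<in> P"
    let ?s = "s - Polynomial.monom (lead_coeff s) (degree s)"
    have d: "?s \<in> polys" "degree ?s < degree s" "poly s x - poly ?s x \<in> P"
      using drop_lead_coeff[of s, OF _ l that] s by blast+
    have "?Q ?s"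
      using d s mem_cong polys_monom[OF one_closed, of 0]
      by (intro multiple[of _ "Polynomial.monom 1 0"]) (auto simp: poly_monom)
    from min[OF this] d(2) show False by simp
  qed
  have "degree s = 0"
  proof (rule ccontr)
    assume "degree s \<noteq> 0"
    hence s0: "degree s > 0" by simp
    \<comment> \<open>Reducing \<open>s\<close> by \<open>m\<close> leaves a candidate again,
      because \<open>lead_coeff m ^ k\<close> is outside \<open>P\<close>; minimality then forces
      \<open>degree s < degree m\<close>.\<close>
    obtain k t r where r: "t \<in> polys" "r \<in> polys" "smult (lead_coeff m ^ k) s = t * m + r"
      "degree r < degree m"
      using pseudo_division[of m s] m s by auto
    have "lead_coeff m ^ k * poly s x - poly r x = poly t x * poly m x"
      using arg_cong[OF r(3), of "\<lambda>p. poly p x"] by (simp add: algebra_simps)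
    hence *: "lead_coeff m ^ k * poly s x - poly r x \<in> P"
      using m by (auto intro: mult_mem)
    have "lead_coeff m ^ k * poly s x \<notin> P"
      using m s prime power_mem by blast
    hence "?Q r"
      using r * mem_cong[OF *] polys_monom[of "lead_coeff m ^ k" 0] m coeff_polys power_closed
      by (intro multiple[of _ "Polynomial.monom (lead_coeff m ^ k) 0"]) (auto simp: poly_monom)
    hence sm: "degree s < degree m"
      using min r(4) by fastforce
    \<comment> \<open>Now \<open>m\<close> is divided by \<open>s\<close>. The value of the
      remainder is a multiple of \<open>poly s x\<close> modulo \<open>P\<close> and its degree is
      below \<open>degree s\<close>, so by minimality the value lies in \<open>P\<close>.\<close>
    obtain k t r where r: "t \<in> polys" "r \<in> polys" "smult (lead_coeff s ^ k) m = t * s + r"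
      "degree r < degree s" "degree t \<le> degree m - degree s"
      using pseudo_division[of s m] m s s0 by auto
    have eq: "lead_coeff s ^ k * poly m x = poly t x * poly s x + poly r x"
      using arg_cong[OF r(3), of "\<lambda>p. poly p x"] by simp
    have rP: "poly r x \<in> P"
    proof (rule ccontr)
      assume nr: "poly r x \<notin> P"
      have "?Q r"
      proof (rule multiple[of _ "0 - t"])
        have "poly (0 - t) x * poly s x - poly r x = - (lead_coeff s ^ k * poly m x)"
          unfolding eq by (simp add: algebra_simps)
        thus "poly (0 - t) x * poly s x - poly r x \<in> P"
          using m by (auto intro: uminus_mem mult_mem)
      qed (use r nr polys_diff[OF polys_zero, of t] in auto)
      from min[OF this] r(4) show False by simp
    qed
    have "poly t x * poly s x + poly r x \<in> P"
      using m by (simp flip: eq add: mult_mem)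
    hence "poly t x * poly s x \<in> P"
      using rP mem_add_cancel by (metis add.commute)
    hence "poly t x \<in> P"
      using prime s by blast
    moreover have "degree t < degree m"
      using r(5) s0 sm by linarith
    ultimately have t: "coeff t j \<in> P" for j
      using mm r(1) by (auto simp: minimal_poly_mod_def)
    have rc: "coeff r j \<in> P" for j
      using mm r(2,4) rP sm by (auto simp: minimal_poly_mod_def)
    \<comment> \<open>Both \<open>t\<close> and \<open>r\<close> kill \<open>x\<close> modulo
      \<open>P\<close> and have degree below \<open>degree m\<close>, so all their coefficients lie
      in \<open>P\<close>. Comparing top coefficients contradicts that neither leading coefficient
      is in \<open>P\<close>.\<close>
    have "coeff (t * s + r) (degree m) \<in> P"
      by (auto simp: coeff_mult intro!: add_mem sum_mem mult_mem_right t rc)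
    moreover have "coeff (t * s + r) (degree m) = lead_coeff s ^ k * lead_coeff m"
      by (simp flip: r(3))
    ultimately show False
      using prime power_mem lead[OF s0] m(3) by metis
  qed
  hence "poly s x = coeff s 0"
    by (auto elim!: degree_eq_zeroE)
  thus ?thesis
    using s u by (auto intro!: bexI[of _ u] bexI[of _ "coeff s 0"] coeff_polys)
qed

end

section \<open>Formal derivatives and derivations of a commutative ring\<close>

lemma poly_eq_sum_atMost: "degree (p :: 'a::comm_ring_1 poly) \<le> n \<Longrightarrow> poly p x = (\<Sum>k\<le>n. coeff p k * x ^ k)"
  unfolding poly_altdef by (intro sum.mono_neutral_left) (auto simp: coeff_eq_0)

definition formal_deriv :: "'a::comm_ring_1 poly \<Rightarrow> 'a poly"
  where "formal_deriv q = (\<Sum>k=1..degree q. Polynomial.monom (of_nat k * coeff q k) (k - 1))"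

lemma coeff_formal_deriv: "coeff (formal_deriv q) k = of_nat (Suc k) * coeff q (Suc k)"
proof -
  have "coeff (formal_deriv q) k =
    (\<Sum>j=1..degree q. if Suc k = j then of_nat j * coeff q j else 0)"
    unfolding formal_deriv_def coeff_sum by (intro sum.cong) auto
  also have "\<dots> = of_nat (Suc k) * coeff q (Suc k)"
    by (subst sum.delta') (auto simp: coeff_eq_0)
  finally show ?thesis .
qed

lemma degree_formal_deriv: "degree q > 0 \<Longrightarrow> degree (formal_deriv q) < degree q"
  by (rule le_less_trans[of _ "degree q - 1"]) (auto intro!: degree_le simp: coeff_formal_deriv coeff_eq_0)

lemma (in unital_subring) polys_formal_deriv: "q \<in> polys \<Longrightarrow> formal_deriv q \<in> polys"
  unfolding polys_def mem_Collect_eq coeff_formal_deriv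
  by (intro allI mult_closed of_nat_closed) auto

locale ring_derivation =
  fixes \<delta> :: "'a::comm_ring_1 \<Rightarrow> 'a"
  assumes add: "\<delta> (a + b) = \<delta> a + \<delta> b"
    and leibniz: "\<delta> (a * b) = \<delta> a * b + a * \<delta> b"
begin

lemma zero: "\<delta> 0 = 0"
  using add[of 0 0] by simp

lemma one: "\<delta> 1 = 0"
  using leibniz[of 1 1] by simp

lemma uminus: "\<delta> (- a) = - \<delta> a"
  using add[of a "- a"] zero by (simp add: eq_neg_iff_add_eq_0 add.commute)

lemma diff: "\<delta> (a - b) = \<delta> a - \<delta> b"
  using add[of a "- b"] uminus by simp

lemma sum: "\<delta> (sum f A) = (\<Sum>x\<in>A. \<delta> (f x))"
  by (induction A rule: infinite_finite_induct) (auto simp: zero add)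

lemma power: "\<delta> (a ^ k) = of_nat k * a ^ (k - 1) * \<delta> a"
proof (induction k)
  case (Suc k)
  thus ?case
    by (cases k) (auto simp: leibniz algebra_simps)
qed (simp add: one)

text \<open>The chain rule: the coefficients are themselves ring elements, so they contribute a term
  of their own.\<close>

lemma poly: "\<delta> (poly q x) = poly (map_poly \<delta> q) x + poly (formal_deriv q) x * \<delta> x"
proof -
  have "degree (map_poly \<delta> q) \<le> degree q"
    by (rule map_poly_degree_leq)
  hence 1: "poly (map_poly \<delta> q) x = (\<Sum>k\<le>degree q. \<delta> (coeff q k) * x ^ k)"
    by (simp add: poly_eq_sum_atMost coeff_map_poly zero)
  \<comment> \<open>For \<open>k = 0\<close> the truncated exponent is harmless, since the factor
    \<open>of_nat k\<close> vanishes.\<close>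
  have 2: "poly (formal_deriv q) x = (\<Sum>k\<le>degree q. of_nat k * coeff q k * x ^ (k - 1))"
    unfolding formal_deriv_def poly_sum poly_monom
    by (intro sum.mono_neutral_left) (auto simp: Suc_le_eq)
  have "\<delta> (poly q x) = (\<Sum>k\<le>degree q. \<delta> (coeff q k * x ^ k))"
    by (simp add: poly_altdef sum)
  also have "\<dots> = (\<Sum>k\<le>degree q. \<delta> (coeff q k) * x ^ k + of_nat k * coeff q k * x ^ (k - 1) * \<delta> x)"
    by (intro sum.cong refl) (simp add: leibniz power algebra_simps)
  finally show ?thesis
    by (simp add: 1 2 sum.distrib sum_distrib_right)
qed

end

section \<open>Polynomials and polynomial vector fields\<close>

definition mpoly_var :: "'n \<Rightarrow> ('n::finite, 'k::comm_ring_1) mpoly"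
  where "mpoly_var i = Poly_Mapping.single (Poly_Mapping.single i 1) 1"

text \<open>These subrings interpolate between the constants and all polynomials, so that arguments
  can add one variable at a time.\<close>

definition mpolys_in :: "'n set \<Rightarrow> ('n::finite, 'k::comm_ring_1) mpoly set"
  where "mpolys_in S = {f. \<forall>m\<in>Poly_Mapping.keys f. Poly_Mapping.keys m \<subseteq> S}"

definition vfield :: "('n \<Rightarrow> ('n, 'k) mpoly) \<Rightarrow> ('n::finite, 'k::comm_ring_1) mpoly \<Rightarrow> ('n, 'k) mpoly"
  where "vfield w f = (\<Sum>i\<in>UNIV. w i * partial_deriv i f)"

lemma mpoly_eq_sum_monomials:
  "(\<Sum>m\<in>Poly_Mapping.keys f. Poly_Mapping.single m (Poly_Mapping.lookup f m)) = (f :: ('n, 'k::comm_ring_1) mpoly)"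
proof (rule poly_mapping_eqI)
  fix m
  have "Poly_Mapping.lookup (\<Sum>m\<in>Poly_Mapping.keys f. Poly_Mapping.single m (Poly_Mapping.lookup f m)) m =
    (\<Sum>m'\<in>Poly_Mapping.keys f. if m' = m then Poly_Mapping.lookup f m' else 0)"
    unfolding lookup_sum by (intro sum.cong) (auto simp: lookup_single when_def)
  also have "\<dots> = Poly_Mapping.lookup f m"
    by (subst sum.delta) (auto simp: in_keys_iff)
  finally show "Poly_Mapping.lookup (\<Sum>m\<in>Poly_Mapping.keys f. Poly_Mapping.single m (Poly_Mapping.lookup f m)) m =
    Poly_Mapping.lookup f m" .
qed

lemma eval_mpoly_const [simp]: "eval_mpoly (const_poly c) x = c"
  by (simp add: eval_mpoly_single)

lemma eval_mpoly_one [simp]: "eval_mpoly 1 x = 1"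
  using eval_mpoly_const[of 1 x] by simp

lemma eval_mpoly_var [simp]:
  fixes x :: "'k::comm_ring_1 ^ 'n::finite"
  shows "eval_mpoly (mpoly_var i) x = x $ i"
proof -
  have "(\<Prod>j\<in>UNIV. x $ j ^ Poly_Mapping.lookup (Poly_Mapping.single i 1) j) = (\<Prod>j\<in>UNIV. if j = i then x $ j else 1)"
    by (intro prod.cong) (auto simp: lookup_single when_def)
  thus ?thesis
    by (simp add: mpoly_var_def eval_mpoly_single)
qed

lemma eval_mpoly_diff: "eval_mpoly (f - g) x = eval_mpoly f x - eval_mpoly g x"
  using eval_mpoly_add[of f "- g" x] by (simp add: eval_mpoly_uminus)

lemma eval_mpoly_sum: "eval_mpoly (sum f A) x = (\<Sum>a\<in>A. eval_mpoly (f a) x)"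
  by (induction A rule: infinite_finite_induct) (auto simp: eval_mpoly_add)

lemma eval_mpoly_prod: "eval_mpoly (prod f A) x = (\<Prod>a\<in>A. eval_mpoly (f a) x)"
  by (induction A rule: infinite_finite_induct) (auto simp: eval_mpoly_mult)

lemma eval_mpoly_power: "eval_mpoly (f ^ k) x = eval_mpoly f x ^ k"
  by (induction k) (auto simp: eval_mpoly_mult)

lemma eval_mpoly_of_int: "eval_mpoly (of_int k) x = of_int k"
  using eval_mpoly_const[of "of_int k" x] by simp

lemma eval_mpoly_cong:
  fixes x y :: "'k::comm_ring_1 ^ 'n::finite"
  assumes "f \<in> mpolys_in S" "\<And>i. i \<in> S \<Longrightarrow> x $ i = y $ i"
  shows "eval_mpoly f x = eval_mpoly f y"
  unfolding eval_mpoly_def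
proof (intro sum.cong refl arg_cong2[where f = "(*)"] prod.cong)
  fix m i assume "m \<in> Poly_Mapping.keys f"
  hence "i \<in> S \<or> Poly_Mapping.lookup m i = 0"
    using assms(1) unfolding mpolys_in_def mem_Collect_eq subset_iff by (metis in_keys_iff)
  thus "x $ i ^ Poly_Mapping.lookup m i = y $ i ^ Poly_Mapping.lookup m i"
    using assms(2) by auto
qed

lemma const_mpolys_in: "const_poly c \<in> mpolys_in S"
  by (cases "c = 0") (auto simp: mpolys_in_def)

lemma var_mpolys_in: "i \<in> S \<Longrightarrow> mpoly_var i \<in> mpolys_in S"
  by (auto simp: mpolys_in_def mpoly_var_def)

lemma mpolys_in_mono: "S \<subseteq> T \<Longrightarrow> mpolys_in S \<subseteq> mpolys_in T"
  by (auto simp: mpolys_in_def)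

lemma mpolys_in_UNIV: "mpolys_in UNIV = UNIV"
  by (simp add: mpolys_in_def)

lemma mpolys_in_empty: "f \<in> mpolys_in {} \<Longrightarrow> f = const_poly (Poly_Mapping.lookup f 0)"
  by (rule poly_mapping_eqI) (auto simp: mpolys_in_def lookup_single when_def in_keys_iff)

lemma unital_subring_mpolys_in: "unital_subring (mpolys_in S :: ('n::finite, 'k::comm_ring_1) mpoly set)"
proof
  show "(1 :: ('n, 'k) mpoly) \<in> mpolys_in S"
    using const_mpolys_in[of 1] by simp
next
  fix f g :: "('n, 'k) mpoly" assume *: "f \<in> mpolys_in S" "g \<in> mpolys_in S"
  show "f - g \<in> mpolys_in S"
    using * keys_diff[of f g] unfolding mpolys_in_def by blast
  show "f * g \<in> mpolys_in S"
  proof -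
    have "Poly_Mapping.keys m \<subseteq> S" if "m \<in> Poly_Mapping.keys (f * g)" for m
    proof -
      obtain a b where "m = a + b" "a \<in> Poly_Mapping.keys f" "b \<in> Poly_Mapping.keys g"
        using keys_mult \<open>m \<in> _\<close> by blast
      thus ?thesis
        using * keys_add[of a b] unfolding mpolys_in_def by blast
    qed
    thus ?thesis by (simp add: mpolys_in_def)
  qed
qed

interpretation mpolys_in: unital_subring "mpolys_in S :: ('n::finite, 'k::comm_ring_1) mpoly set"
  for S by (rule unital_subring_mpolys_in)

text \<open>The monomials are grouped by their exponent at \<open>i\<close>; \<open>?r\<close>
  strips that variable from a monomial.\<close>

lemma mpolys_in_insert:
  assumes "f \<in> mpolys_in (insert i S)"
  shows "\<exists>q\<in>mpolys_in.polys S. f = poly q (mpoly_var i)"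
proof -
  let ?r = "\<lambda>m. m - Poly_Mapping.single i (Poly_Mapping.lookup m i)"
  let ?c = "\<lambda>m. Polynomial.monom (Poly_Mapping.single (?r m) (Poly_Mapping.lookup f m)) (Poly_Mapping.lookup m i)"
  have pow: "mpoly_var i ^ k = (Poly_Mapping.single (Poly_Mapping.single i k) 1 :: ('a, 'b) mpoly)" for k
    by (induction k) (auto simp: mpoly_var_def mult_single single_add[symmetric])
  have r: "?r m + Poly_Mapping.single i (Poly_Mapping.lookup m i) = m" for m :: "'a \<Rightarrow>\<^sub>0 nat"
    by (rule poly_mapping_eqI) (auto simp: lookup_add lookup_minus lookup_single when_def)
  have "f = poly (\<Sum>m\<in>Poly_Mapping.keys f. ?c m) (mpoly_var i)"
    by (simp add: poly_sum poly_monom pow mult_single r mpoly_eq_sum_monomials)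
  moreover have "(\<Sum>m\<in>Poly_Mapping.keys f. ?c m) \<in> mpolys_in.polys S"
    unfolding mpolys_in.polys_def mem_Collect_eq coeff_sum
  proof (intro allI mpolys_in.sum_closed)
    fix k m assume "m \<in> Poly_Mapping.keys f"
    hence "Poly_Mapping.keys m \<subseteq> insert i S"
      using assms by (auto simp: mpolys_in_def)
    hence "Poly_Mapping.keys (?r m) \<subseteq> S"
      by (auto simp: subset_iff in_keys_iff lookup_minus lookup_single when_def split: if_splits)
    thus "coeff (?c m) k \<in> mpolys_in S"
      by (auto simp: mpolys_in_def)
  qed
  ultimately show ?thesis by blast
qed

lemma poly_var_mpolys_in_insert:
  assumes "q \<in> mpolys_in.polys S"
  shows "poly q (mpoly_var i) \<in> mpolys_in (insert i S)"
  unfolding poly_altdef using assms mpolys_in_mono[of S "insert i S"]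
  by (intro mpolys_in.sum_closed mpolys_in.mult_closed mpolys_in.power_closed var_mpolys_in)
     (auto simp: mpolys_in.polys_def)

lemma eval_mpoly_poly:
  fixes q :: "('n::finite, 'k::comm_ring_1) mpoly poly"
  shows "eval_mpoly (poly q f) x = poly (map_poly (\<lambda>c. eval_mpoly c x) q) (eval_mpoly f x)"
proof -
  have "degree (map_poly (\<lambda>c. eval_mpoly c x) q) \<le> degree q"
    by (rule map_poly_degree_leq)
  thus ?thesis
    by (simp add: poly_eq_sum_atMost coeff_map_poly poly_altdef[of q] eval_mpoly_sum eval_mpoly_mult
        eval_mpoly_power)
qed

section \<open>Partial derivatives and vector fields on affine space\<close>

lemma partial_deriv_add: "partial_deriv i (f + g) = partial_deriv i f + partial_deriv i g"
  unfolding partial_deriv_def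
  by (rule setsum_keys_plus_distrib) (simp_all add: algebra_simps single_add)

lemma partial_deriv_single:
  "partial_deriv i (Poly_Mapping.single m c) =
    Poly_Mapping.single (m - Poly_Mapping.single i 1) (of_nat (Poly_Mapping.lookup m i) * c)"
  by (cases "c = 0") (simp_all add: partial_deriv_def)

lemma partial_deriv_zero [simp]: "partial_deriv i 0 = 0"
  by (simp add: partial_deriv_def)

lemma partial_deriv_const [simp]: "partial_deriv i (const_poly c) = 0"
  by (simp add: partial_deriv_single)

lemma partial_deriv_var: "partial_deriv i (mpoly_var j) = (if i = j then 1 else 0)"
  by (simp add: mpoly_var_def partial_deriv_single lookup_single when_def)

lemma partial_deriv_mult_single:
  "partial_deriv i (Poly_Mapping.single m c * Poly_Mapping.single m' c') =
    partial_deriv i (Poly_Mapping.single m c) * Poly_Mapping.single m' c' +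
    Poly_Mapping.single m c * partial_deriv i (Poly_Mapping.single m' (c' :: 'k::comm_ring_1))"
proof -
  \<comment> \<open>Truncated subtraction commutes with adding \<open>b\<close> only when the
    exponent at \<open>i\<close> is positive; otherwise both coefficients are zero.\<close>
  have shift: "Poly_Mapping.single (a - Poly_Mapping.single i 1 + b) (of_nat (Poly_Mapping.lookup a i) * d) =
    Poly_Mapping.single (a + b - Poly_Mapping.single i 1) (of_nat (Poly_Mapping.lookup a i) * d)"
    for a b :: "'a \<Rightarrow>\<^sub>0 nat" and d :: 'k
  proof (cases "Poly_Mapping.lookup a i = 0")
    case False
    hence "a - Poly_Mapping.single i 1 + b = a + b - Poly_Mapping.single i 1"
      by (intro poly_mapping_eqI) (auto simp: lookup_add lookup_minus lookup_single when_def)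
    thus ?thesis by simp
  qed simp
  have "Poly_Mapping.single (m + (m' - Poly_Mapping.single i 1)) (of_nat (Poly_Mapping.lookup m' i) * (c * c')) =
    Poly_Mapping.single (m + m' - Poly_Mapping.single i 1) (of_nat (Poly_Mapping.lookup m' i) * (c * c'))"
    using shift[of m' m "c * c'"] by (simp add: add.commute)
  with shift[of m m' "c * c'"] show ?thesis
    by (simp add: mult_single partial_deriv_single lookup_add distrib_right single_add mult.assoc mult.left_commute[of c])
qed

lemma partial_deriv_mult:
  "partial_deriv i (f * g) = partial_deriv i f * g + f * partial_deriv i g"
proof (induction f rule: mpoly_induct)
  case (add f m c)
  have "partial_deriv i (Poly_Mapping.single m c * g) =
    partial_deriv i (Poly_Mapping.single m c) * g + Poly_Mapping.single m c * partial_deriv i g"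
  proof (induction g rule: mpoly_induct)
    case (add g m' c')
    thus ?case
      by (simp add: distrib_left partial_deriv_add partial_deriv_mult_single)
  qed simp
  with add show ?case by (simp add: distrib_right partial_deriv_add algebra_simps)
qed simp

interpretation partial_deriv: ring_derivation "partial_deriv i :: ('n::finite, 'k::comm_ring_1) mpoly \<Rightarrow> _" for i
  by unfold_locales (rule partial_deriv_add partial_deriv_mult)+

interpretation vfield: ring_derivation "vfield w :: ('n::finite, 'k::comm_ring_1) mpoly \<Rightarrow> _" for w
proof
  fix f g :: "('n, 'k) mpoly"
  show "vfield w (f + g) = vfield w f + vfield w g"
    by (simp add: vfield_def partial_deriv_add distrib_left sum.distrib)
  have "w i * (partial_deriv i f * g + f * partial_deriv i g) =
    w i * partial_deriv i f * g + f * (w i * partial_deriv i g)" for i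
    by (simp add: distrib_left mult.assoc mult.left_commute)
  thus "vfield w (f * g) = vfield w f * g + f * vfield w g"
    by (simp add: vfield_def partial_deriv_mult sum.distrib sum_distrib_left sum_distrib_right)
qed

lemma partial_deriv_eq_0:
  assumes "f \<in> mpolys_in S" "i \<notin> S"
  shows "partial_deriv i f = 0"
  unfolding partial_deriv_def
proof (intro sum.neutral ballI)
  fix m assume "m \<in> Poly_Mapping.keys f"
  hence "i \<notin> Poly_Mapping.keys m"
    using assms by (auto simp: mpolys_in_def)
  thus "Poly_Mapping.single (m - Poly_Mapping.single i 1)
      (of_nat (Poly_Mapping.lookup m i) * Poly_Mapping.lookup f m) = 0"
    by (simp add: in_keys_iff)
qed

lemma partial_deriv_mpolys_in: "f \<in> mpolys_in S \<Longrightarrow> partial_deriv i f \<in> mpolys_in S"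
  unfolding partial_deriv_def
proof (intro mpolys_in.sum_closed)
  fix m assume "f \<in> mpolys_in S" "m \<in> Poly_Mapping.keys f"
  thus "Poly_Mapping.single (m - Poly_Mapping.single i 1) (of_nat (Poly_Mapping.lookup m i) * Poly_Mapping.lookup f m)
    \<in> mpolys_in S"
    by (auto simp: mpolys_in_def in_keys_iff lookup_minus subset_iff split: if_splits)
qed

lemma vfield_const [simp]: "vfield w (const_poly c) = 0"
  by (simp add: vfield_def)

lemma vfield_var [simp]: "vfield w (mpoly_var i) = w i"
  by (simp add: vfield_def partial_deriv_var if_distrib[where f = "\<lambda>x. _ * x"] cong: if_cong)

lemma vfield_scaled:
  assumes "f \<in> mpolys_in S" "\<And>i. i \<in> S \<Longrightarrow> w' i = c * w i"
  shows "vfield w' f = c * vfield w f"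
  unfolding vfield_def sum_distrib_left
proof (intro sum.cong refl)
  fix i
  show "w' i * partial_deriv i f = c * (w i * partial_deriv i f)"
    using assms partial_deriv_eq_0[OF assms(1), of i] by (cases "i \<in> S") (auto simp: algebra_simps)
qed

section \<open>The weak Nullstellensatz\<close>

locale mpoly_prime = ring_prime_ideal P
  for P :: "('n::finite, 'k::field) mpoly set"
begin

sublocale sub: subring_mod_prime "mpolys_in S" P for S ..

lemma const_notin: "c \<noteq> 0 \<Longrightarrow> const_poly c \<notin> P"
  using mult_mem[of "const_poly c" "const_poly (inverse c)"] one_notin by (auto simp: mult_single)

lemma not_algebraic_coeffs_mem:
  "\<not> sub.algebraic_mod S x \<Longrightarrow> q \<in> mpolys_in.polys S \<Longrightarrow> poly q x \<in> P \<Longrightarrow> coeff q k \<in> P"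
  by (auto simp: sub.algebraic_mod_def)

end

text \<open>A Chevalley-type step in which \<open>y\<close> is \<open>x\<close> with a new
  coordinate at \<open>i\<close>. If \<open>mpoly_var i\<close> is transcendental modulo
  \<open>P\<close>, all members of \<open>P\<close> become zero once their coefficients are
  evaluated at \<open>x\<close>, and any non-root of \<open>f\<close> will do. Otherwise the new
  coordinate is a root of the minimal polynomial.\<close>

lemma point_extension:
  fixes P :: "('n::finite, 'k::{alg_closed_field, field_char_0}) mpoly set"
  assumes "mpoly_prime P" and i: "i \<notin> S" and f: "f \<in> mpolys_in (insert i S)" "f \<notin> P"
  shows "\<exists>b\<in>mpolys_in S. b \<notin> P \<and>
    (\<forall>x. (\<forall>g\<in>P \<inter> mpolys_in S. eval_mpoly g x = 0) \<and> eval_mpoly b x \<noteq> 0 \<longrightarrow>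
      (\<exists>y. (\<forall>g\<in>P \<inter> mpolys_in (insert i S). eval_mpoly g y = 0) \<and> eval_mpoly f y \<noteq> 0))"
proof -
  interpret mpoly_prime P by fact
  let ?X = "mpoly_var i :: ('n, 'k) mpoly"
  define ext where "ext x y = (\<chi> j. if j = i then y else x $ j)" for x :: "'k ^ 'n" and y
  define ev where "ev x q = map_poly (\<lambda>c. eval_mpoly c x) q" for x :: "'k ^ 'n" and q :: "('n, 'k) mpoly poly"
  have coeff_ev: "coeff (ev x q) k = eval_mpoly (coeff q k) x" for x q k
    by (simp add: ev_def coeff_map_poly)
  have eval_ext: "eval_mpoly (poly q ?X) (ext x y) = poly (ev x q) y" if "q \<in> mpolys_in.polys S" for q x y
  proof -
    have "ev (ext x y) q = ev x q"
      using that i by (intro poly_eqI, unfold coeff_ev, intro eval_mpoly_cong[of _ S])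
        (auto simp: mpolys_in.polys_def ext_def)
    thus ?thesis
      by (simp add: eval_mpoly_poly ev_def[symmetric]) (simp add: ext_def)
  qed
  obtain q where q: "q \<in> mpolys_in.polys S" "f = poly q ?X"
    using mpolys_in_insert[OF f(1)] by blast
  show ?thesis
  proof (cases "sub.algebraic_mod S ?X")
    case False
    obtain k where k: "coeff q k \<notin> P"
      using poly_mem f(2) q(2) by blast
    show ?thesis
    proof (intro bexI[of _ "coeff q k"] conjI allI impI k; (elim conjE)?)
      fix x assume x: "\<forall>g\<in>P \<inter> mpolys_in S. eval_mpoly g x = 0" "eval_mpoly (coeff q k) x \<noteq> 0"
      hence "ev x q \<noteq> 0" by (auto simp flip: coeff_ev)
      hence "finite {y. poly (ev x q) y = 0}" by (rule poly_roots_finite)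
      then obtain y where y: "poly (ev x q) y \<noteq> 0"
        using ex_new_if_finite[OF infinite_UNIV_char_0] by blast
      have "eval_mpoly g (ext x y) = 0" if g: "g \<in> P \<inter> mpolys_in (insert i S)" for g
      proof -
        obtain r where r: "r \<in> mpolys_in.polys S" "g = poly r ?X"
          using mpolys_in_insert g by blast
        hence "ev x r = 0"
          using not_algebraic_coeffs_mem[OF False r(1)] g x(1)
          by (intro poly_eqI) (auto simp: coeff_ev mpolys_in.coeff_polys)
        thus ?thesis using eval_ext r by simp
      qed
      thus "\<exists>y. (\<forall>g\<in>P \<inter> mpolys_in (insert i S). eval_mpoly g y = 0) \<and> eval_mpoly f y \<noteq> 0"
        using y eval_ext[OF q(1)] q(2) by (intro exI[of _ "ext x y"]) auto
    qed (use q in \<open>auto simp: mpolys_in.coeff_polys\<close>)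
  next
    case True
    obtain m where m: "sub.minimal_poly_mod S ?X m"
      using sub.ex_minimal_poly_mod[OF True] by blast
    hence m': "m \<in> mpolys_in.polys S" "poly m ?X \<in> P" "lead_coeff m \<notin> P" "degree m > 0"
      by (auto simp: sub.minimal_poly_mod_def)
    obtain u b where u: "u \<in> mpolys_in.polys S" "b \<in> mpolys_in S" "b \<notin> P" "poly u ?X * f - b \<in> P"
      using sub.algebraic_multiple_in_subring[OF True, of q] q f(2) by blast
    show ?thesis
    proof (intro bexI[of _ "lead_coeff m * b"] conjI allI impI; (elim conjE)?)
      fix x assume x: "\<forall>g\<in>P \<inter> mpolys_in S. eval_mpoly g x = 0" "eval_mpoly (lead_coeff m * b) x \<noteq> 0"
      \<comment> \<open>The factor \<open>lead_coeff m\<close> keeps the specialised polynomial from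
        becoming constant, so it has a root.\<close>
      have "coeff (ev x m) (degree m) \<noteq> 0"
        using x(2) by (auto simp: coeff_ev eval_mpoly_mult)
      hence "degree (ev x m) > 0"
        using m'(4) by (metis le_degree less_le_trans)
      then obtain y where y: "poly (ev x m) y = 0"
        using alg_closed_imp_poly_has_root by blast
      have vanish: "eval_mpoly g (ext x y) = 0" if g: "g \<in> P" "g \<in> mpolys_in (insert i S)" for g
      proof -
        obtain p where p: "p \<in> mpolys_in.polys S" "g = poly p ?X"
          using mpolys_in_insert g by blast
        hence "poly p ?X \<in> P" using g(1) by simp
        then obtain k s r where r: "s \<in> mpolys_in.polys S" "r \<in> mpolys_in.polys S"
          "smult (lead_coeff m ^ k) p = s * m + r" "\<And>k. coeff r k \<in> P"
          by (rule sub.minimal_poly_mod_division[OF m p(1)]) (rule that)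
        have "ev x r = 0"
          using r(2,4) x(1) by (intro poly_eqI) (auto simp: coeff_ev mpolys_in.coeff_polys)
        hence "eval_mpoly (poly r ?X) (ext x y) = 0" "eval_mpoly (poly m ?X) (ext x y) = 0"
          using eval_ext r(2) m'(1) y by auto
        \<comment> \<open>Both \<open>m\<close> and \<open>r\<close> vanish at the new point, so the
          division identity kills \<open>g\<close> times a power of \<open>lead_coeff m\<close>,
          which is nonzero there.\<close>
        moreover have "eval_mpoly (poly (smult (lead_coeff m ^ k) p) ?X) (ext x y) = eval_mpoly (poly (s * m + r) ?X) (ext x y)"
          by (simp only: r(3))
        ultimately have "eval_mpoly (lead_coeff m) (ext x y) ^ k * eval_mpoly g (ext x y) = 0"
          by (simp add: p(2) eval_mpoly_mult eval_mpoly_add eval_mpoly_power)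
        moreover have "eval_mpoly (lead_coeff m) (ext x y) = eval_mpoly (lead_coeff m) x"
          using m'(1) i by (intro eval_mpoly_cong[of _ S]) (auto simp: mpolys_in.coeff_polys ext_def)
        ultimately show ?thesis
          using x(2) by (simp add: eval_mpoly_mult)
      qed
      \<comment> \<open>This relation lies in \<open>P\<close> and hence vanishes at the new point,
        so \<open>f\<close> cannot vanish there unless \<open>b\<close> does.\<close>
      have "poly u ?X * f - b \<in> mpolys_in (insert i S)"
        using u(1,2) f(1) mpolys_in_mono[of S "insert i S"]
        by (intro mpolys_in.diff_closed mpolys_in.mult_closed poly_var_mpolys_in_insert) auto
      hence "eval_mpoly (poly u ?X * f - b) (ext x y) = 0"
        using vanish u(4) by blast
      moreover have "eval_mpoly b (ext x y) = eval_mpoly b x"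
        using u(2) i by (intro eval_mpoly_cong[of _ S]) (auto simp: ext_def)
      ultimately have "eval_mpoly f (ext x y) \<noteq> 0"
        using x(2) by (auto simp: eval_mpoly_diff eval_mpoly_mult)
      thus "\<exists>y. (\<forall>g\<in>P \<inter> mpolys_in (insert i S). eval_mpoly g y = 0) \<and> eval_mpoly f y \<noteq> 0"
        using vanish by (intro exI[of _ "ext x y"]) auto
    next
      show "lead_coeff m * b \<notin> P" using m'(3) u(3) prime by blast
      show "lead_coeff m * b \<in> mpolys_in S"
        using m'(1) u(2) by (intro mpolys_in.mult_closed) (auto simp: mpolys_in.coeff_polys)
    qed
  qed
qed

text \<open>\<open>point_extension\<close> trades the condition that \<open>f\<close> be nonzero for
  one on a polynomial in fewer variables, until only constants remain. The induction carries a
  general \<open>f\<close>; the result is the case \<open>f = 1\<close>.\<close>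

lemma ex_zero_of_prime:
  fixes P :: "('n::finite, 'k::{alg_closed_field, field_char_0}) mpoly set"
  assumes "mpoly_prime P"
  shows "\<exists>x. \<forall>g\<in>P. eval_mpoly g x = 0"
proof -
  interpret mpoly_prime P by fact
  have "\<exists>x. (\<forall>g\<in>P \<inter> mpolys_in S. eval_mpoly g x = 0) \<and> eval_mpoly f x \<noteq> 0"
    if "f \<in> mpolys_in S" "f \<notin> P" for f and S :: "'n set"
    using finite[of S] that
  proof (induction S arbitrary: f rule: finite_induct)
    case empty
    have "eval_mpoly g x = 0" if "g \<in> P" "g \<in> mpolys_in {}" for g and x :: "'k ^ 'n"
      using that mpolys_in_empty[of g] const_notin[of "Poly_Mapping.lookup g 0"] by (metis eval_mpoly_const)
    moreover have "eval_mpoly f x \<noteq> 0" for x :: "'k ^ 'n"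
      using empty mpolys_in_empty[of f] zero_mem by (metis eval_mpoly_const single_zero)
    ultimately show ?case by blast
  next
    case (insert i S)
    show ?case
      using point_extension[OF assms insert.hyps(2) insert.prems] insert.IH by blast
  qed
  from this[of 1 UNIV] show ?thesis
    using one_notin by (auto simp: mpolys_in_UNIV)
qed

text \<open>Zorn's lemma yields a maximal proper ideal \<open>M\<close>. If \<open>a\<close> is
  outside \<open>M\<close>, then \<open>1\<close> lies in \<open>M\<close> plus the multiples of
  \<open>a\<close>, and multiplying by \<open>b\<close> gives primality.\<close>

lemma ex_prime_ideal_above:
  fixes I :: "'a::comm_ring_1 set"
  assumes "ring_ideal I" "1 \<notin> I"
  shows "\<exists>P. ring_prime_ideal P \<and> I \<subseteq> P"
proof -
  define A where "A = {J. ring_ideal J \<and> 1 \<notin> J \<and> I \<subseteq> J}"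
  have "\<exists>M\<in>A. \<forall>J\<in>A. M \<subseteq> J \<longrightarrow> J = M"
  proof (rule subset_Zorn_nonempty)
    show "A \<noteq> {}" using assms by (auto simp: A_def)
    fix C assume C: "C \<noteq> {}" "subset.chain A C"
    hence CA: "ring_ideal J" "1 \<notin> J" "I \<subseteq> J" if "J \<in> C" for J
      using that by (auto simp: A_def subset_chain_def)
    have "ring_ideal (\<Union>C)"
    proof
      fix a b assume "a \<in> \<Union>C" "b \<in> \<Union>C"
      then obtain J where "J \<in> C" "a \<in> J" "b \<in> J"
        using C(2) unfolding subset_chain_def by blast
      thus "a + b \<in> \<Union>C" using CA ring_ideal.add_mem by blast
    next
      fix a b assume "b \<in> \<Union>C"
      thus "a * b \<in> \<Union>C" using CA ring_ideal.mult_mem by blast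
    qed (use C CA ring_ideal.zero_mem in blast)
    with CA C(1) show "\<Union>C \<in> A" unfolding A_def by blast
  qed
  then obtain M where M: "ring_ideal M" "1 \<notin> M" "I \<subseteq> M"
    and max: "\<And>J. ring_ideal J \<Longrightarrow> 1 \<notin> J \<Longrightarrow> M \<subseteq> J \<Longrightarrow> J = M"
    by (auto simp: A_def)
  interpret ring_ideal M by fact
  have "a \<in> M \<or> b \<in> M" if ab: "a * b \<in> M" for a b
  proof (rule ccontr)
    assume n: "\<not> (a \<in> M \<or> b \<in> M)"
    let ?J = "{u + v * a | u v. u \<in> M}"
    have "ring_ideal ?J"
    proof
      show "0 \<in> ?J" using zero_mem by (auto intro!: exI[of _ 0])
    next
      fix x y assume "x \<in> ?J" "y \<in> ?J"
      then obtain u v u' v' where "x = u + v * a" "y = u' + v' * a" "u \<in> M" "u' \<in> M" by blast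
      thus "x + y \<in> ?J"
        by (intro CollectI exI[of _ "u + u'"] exI[of _ "v + v'"]) (auto simp: add_mem algebra_simps)
    next
      fix x y assume "y \<in> ?J"
      then obtain u v where "y = u + v * a" "u \<in> M" by blast
      thus "x * y \<in> ?J"
        by (intro CollectI exI[of _ "x * u"] exI[of _ "x * v"]) (auto simp: mult_mem distrib_left mult.assoc)
    qed
    moreover have "M \<subseteq> ?J"
      by (force intro: exI[of _ 0])
    moreover have "a \<in> ?J"
      using zero_mem by (intro CollectI exI[of _ 0] exI[of _ 1]) auto
    ultimately have "1 \<in> ?J" using max[of ?J] n by blast
    then obtain u v where uv: "1 = u + v * a" "u \<in> M" by blast
    have "b = b * u + v * (a * b)"
      using arg_cong[OF uv(1), of "\<lambda>x. x * b"] by (simp add: algebra_simps)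
    also have "\<dots> \<in> M" by (intro add_mem mult_mem[OF uv(2)] mult_mem[OF ab])
    finally show False using n by simp
  qed
  hence "ring_prime_ideal M"
    using M by unfold_locales auto
  thus ?thesis using M(3) by blast
qed

theorem weak_nullstellensatz:
  fixes I :: "('n::finite, 'k::{alg_closed_field, field_char_0}) mpoly set"
  assumes "ring_ideal I" "1 \<notin> I"
  shows "\<exists>x. \<forall>g\<in>I. eval_mpoly g x = 0"
  using ex_prime_ideal_above[OF assms] ex_zero_of_prime by (metis mpoly_prime_def subsetD)

section \<open>Extending derivations\<close>

text \<open>If \<open>mpoly_var i\<close> is transcendental modulo \<open>P\<close>, then
  \<open>w\<close> itself works. Otherwise differentiating its minimal relation dictates the new
  value as a quotient; scaling by the denominator, the derivative of the relation, keeps the field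
  polynomial.\<close>

lemma vfield_extension_step:
  fixes P :: "('n::finite, 'k::field_char_0) mpoly set"
  assumes "mpoly_prime P" and i: "i \<notin> S" and w: "\<forall>g\<in>P \<inter> mpolys_in S. vfield w g \<in> P"
  shows "\<exists>c w'. c \<notin> P \<and> (\<forall>s. s \<noteq> i \<longrightarrow> w' s = c * w s) \<and>
    (\<forall>g\<in>P \<inter> mpolys_in (insert i S). vfield w' g \<in> P)"
proof -
  interpret mpoly_prime P by fact
  let ?X = "mpoly_var i :: ('n, 'k) mpoly"
  have coeffs: "poly (map_poly (vfield w) r) x \<in> P"
    if "r \<in> mpolys_in.polys S" "\<And>k. coeff r k \<in> P" for r x
    using that w by (intro poly_mem) (auto simp: coeff_map_poly vfield.zero mpolys_in.coeff_polys)
  show ?thesis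
  proof (cases "sub.algebraic_mod S ?X")
    case False
    have "vfield w g \<in> P" if g: "g \<in> P \<inter> mpolys_in (insert i S)" for g
    proof -
      obtain r where r: "r \<in> mpolys_in.polys S" "g = poly r ?X"
        using mpolys_in_insert g by blast
      hence rP: "coeff r k \<in> P" for k
        using not_algebraic_coeffs_mem[OF False r(1)] g by auto
      have "coeff (formal_deriv r) k \<in> P" for k
        unfolding coeff_formal_deriv by (intro mult_mem rP)
      thus ?thesis
        unfolding r(2) vfield.poly using coeffs[OF r(1) rP]
        by (intro add_mem mult_mem_right) (auto intro: poly_mem)
    qed
    thus ?thesis
      using one_notin by (intro exI[of _ 1] exI[of _ w]) auto
  next
    case True
    obtain m where m: "sub.minimal_poly_mod S ?X m"
      using sub.ex_minimal_poly_mod[OF True] by blast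
    hence m': "m \<in> mpolys_in.polys S" "poly m ?X \<in> P" "lead_coeff m \<notin> P" "degree m > 0"
      by (auto simp: sub.minimal_poly_mod_def)
    let ?c = "poly (formal_deriv m) ?X"
    let ?w = "\<lambda>s. if s = i then - poly (map_poly (vfield w) m) ?X else ?c * w s"
    \<comment> \<open>By minimality of \<open>m\<close>, a root of its derivative would put
      \<open>degree m\<close> times the leading coefficient into \<open>P\<close>, which
      characteristic 0 forbids.\<close>
    have c: "?c \<notin> P"
    proof
      assume "?c \<in> P"
      hence "coeff (formal_deriv m) (degree m - 1) \<in> P"
        using m mpolys_in.polys_formal_deriv[OF m'(1)] degree_formal_deriv[OF m'(4)]
        by (auto simp: sub.minimal_poly_mod_def)
      hence "of_nat (degree m) * lead_coeff m \<in> P"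
        using m'(4) by (simp add: coeff_formal_deriv)
      moreover have "of_nat (degree m) \<notin> P"
        using const_notin[of "of_nat (degree m)"] m'(4) by simp
      ultimately show False using prime m'(3) by blast
    qed
    have scaled: "vfield ?w g = ?c * vfield w g" if "g \<in> mpolys_in S" for g
      using that i by (intro vfield_scaled) auto
    have map_scaled: "poly (map_poly (vfield ?w) r) x = ?c * poly (map_poly (vfield w) r) x"
      if "r \<in> mpolys_in.polys S" for r x
    proof -
      have "map_poly (vfield ?w) r = smult ?c (map_poly (vfield w) r)"
        using that scaled by (intro poly_eqI) (simp add: coeff_map_poly vfield.zero mpolys_in.coeff_polys)
      thus ?thesis by simp
    qed
    \<comment> \<open>The value at \<open>i\<close> makes the two terms of the chain rule cancel
      exactly, not only modulo \<open>P\<close>.\<close>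
    have m0: "vfield ?w (poly m ?X) = 0"
      unfolding vfield.poly map_scaled[OF m'(1)] by simp
    have "vfield ?w g \<in> P" if g: "g \<in> P" "g \<in> mpolys_in (insert i S)" for g
    proof -
      obtain p where p: "p \<in> mpolys_in.polys S" "g = poly p ?X"
        using mpolys_in_insert g by blast
      hence "poly p ?X \<in> P" using g(1) by simp
      then obtain k s r where r: "s \<in> mpolys_in.polys S" "r \<in> mpolys_in.polys S"
        "smult (lead_coeff m ^ k) p = s * m + r" and rP: "\<And>k. coeff r k \<in> P"
        by (rule sub.minimal_poly_mod_division[OF m p(1)]) (rule that)
      have r': "vfield ?w (poly r ?X) \<in> P"
      proof -
        have "coeff (formal_deriv r) k \<in> P" for k
          unfolding coeff_formal_deriv by (intro mult_mem rP)
        thus ?thesis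
          unfolding vfield.poly map_scaled[OF r(2)] using coeffs[OF r(2) rP]
          by (intro add_mem mult_mem_right[of "poly (formal_deriv r) _"] mult_mem) (auto intro: poly_mem)
      qed
      \<comment> \<open>Applying the field to this identity leaves \<open>vfield ?w g\<close>, times
        an element outside \<open>P\<close>, as the only term not yet known to lie in
        \<open>P\<close>.\<close>
      have "lead_coeff m ^ k * g = poly s ?X * poly m ?X + poly r ?X"
        using arg_cong[OF r(3), of "\<lambda>q. poly q ?X"] by (simp add: p(2))
      hence "vfield ?w (lead_coeff m ^ k * g) = vfield ?w (poly s ?X * poly m ?X + poly r ?X)"
        by simp
      hence "vfield ?w (lead_coeff m ^ k) * g + lead_coeff m ^ k * vfield ?w g =
        vfield ?w (poly s ?X) * poly m ?X + vfield ?w (poly r ?X)"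
        by (simp only: vfield.add vfield.leibniz m0 mult_zero_right add_0_right)
      moreover have "vfield ?w (poly s ?X) * poly m ?X + vfield ?w (poly r ?X) \<in> P"
        using r' m'(2) by (intro add_mem mult_mem)
      ultimately have "vfield ?w (lead_coeff m ^ k) * g + lead_coeff m ^ k * vfield ?w g \<in> P"
        by (simp only:)
      moreover have "vfield ?w (lead_coeff m ^ k) * g \<in> P"
        using g(1) by (rule mult_mem)
      ultimately have "lead_coeff m ^ k * vfield ?w g \<in> P"
        using mem_add_cancel by blast
      thus ?thesis
        using prime power_mem m'(3) by blast
    qed
    thus ?thesis
      using c by (intro exI[of _ ?c] exI[of _ ?w]) auto
  qed
qed

text \<open>The variables outside \<open>S\<close> are adjoined one by one; the scaling factors
  multiply and stay outside the prime \<open>P\<close>.\<close>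

lemma vfield_extension:
  fixes P :: "('n::finite, 'k::field_char_0) mpoly set"
  assumes "mpoly_prime P" and w: "\<forall>g\<in>P \<inter> mpolys_in S. vfield w g \<in> P"
  shows "\<exists>c w'. c \<notin> P \<and> (\<forall>s\<in>S. w' s = c * w s) \<and> (\<forall>g\<in>P. vfield w' g \<in> P)"
proof -
  interpret mpoly_prime P by fact
  have "\<exists>c w'. c \<notin> P \<and> (\<forall>s\<in>S. w' s = c * w s) \<and> (\<forall>g\<in>P \<inter> mpolys_in (S \<union> U). vfield w' g \<in> P)"
    if "U \<inter> S = {}" for U
    using finite[of U] that
  proof (induction U rule: finite_induct)
    case empty
    show ?case using w one_notin by (intro exI[of _ 1] exI[of _ w]) auto
  next
    case (insert i U)
    then obtain c w' where *: "c \<notin> P" "\<forall>s\<in>S. w' s = c * w s"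
      "\<forall>g\<in>P \<inter> mpolys_in (S \<union> U). vfield w' g \<in> P" by blast
    have "i \<notin> S \<union> U" using insert by auto
    from vfield_extension_step[OF assms(1) this *(3)] obtain c' w'' where
      **: "c' \<notin> P" "\<forall>s. s \<noteq> i \<longrightarrow> w'' s = c' * w' s"
      "\<forall>g\<in>P \<inter> mpolys_in (insert i (S \<union> U)). vfield w'' g \<in> P" by blast
    have "\<forall>s\<in>S. w'' s = (c' * c) * w s"
      using * ** \<open>i \<notin> S \<union> U\<close> by (auto simp: mult.assoc)
    moreover have "c' * c \<notin> P" using * ** prime by blast
    ultimately show ?case using ** by (intro exI[of _ "c' * c"] exI[of _ w'']) auto
  qed
  from this[of "- S"] show ?thesis by (simp add: mpolys_in_UNIV)
qed

section \<open>Charts on a smooth variety\<close>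

lemma vec_dim_coordinate_subspace:
  fixes T :: "'n::finite set"
  shows "vec.dim {v :: 'k::field ^ 'n. \<forall>j. j \<notin> T \<longrightarrow> v $ j = 0} = card T"
proof -
  let ?B = "(\<lambda>k. axis k (1::'k)) ` T"
  have "vec.dim {v :: 'k ^ 'n. \<forall>j. j \<notin> T \<longrightarrow> v $ j = 0} = card ?B"
  proof (rule vec.basis_card_eq_dim[symmetric])
    show "?B \<subseteq> {v. \<forall>j. j \<notin> T \<longrightarrow> v $ j = 0}"
      by (auto simp: axis_def)
    show "vec.independent ?B"
      by (rule vec.independent_mono[OF independent_cart_basis]) (auto simp: cart_basis_def)
    show "{v. \<forall>j. j \<notin> T \<longrightarrow> v $ j = 0} \<subseteq> vec.span ?B"
    proof
      fix v :: "'k ^ 'n" assume v: "v \<in> {v. \<forall>j. j \<notin> T \<longrightarrow> v $ j = 0}"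
      have "v = (\<Sum>i\<in>UNIV. v $ i *s axis i 1)"
        by (rule basis_expansion[symmetric])
      also have "\<dots> = (\<Sum>i\<in>T. v $ i *s axis i 1)"
        using v by (intro sum.mono_neutral_right) auto
      also have "\<dots> \<in> vec.span ?B"
        by (intro vec.span_sum vec.span_scale vec.span_base) auto
      finally show "v \<in> vec.span ?B" .
    qed
  qed
  also have "card ?B = card T"
    by (intro card_image inj_onI) (simp add: axis_eq_axis)
  finally show ?thesis .
qed

text \<open>\<open>A\<close> maps the space isomorphically onto a coordinate subspace. This will
  count the dimension of a tangent space cut out by the rows outside \<open>T\<close>.\<close>

lemma vec_dim_preimage_coordinate_subspace:
  fixes A :: "'k::field ^ 'n::finite ^ 'n"
  assumes "det A \<noteq> 0"
  shows "vec.dim {v. \<forall>j. j \<notin> T \<longrightarrow> (A *v v) $ j = 0} = card T"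
proof -
  have inv: "invertible A" using assms by (simp add: invertible_det_nz)
  let ?U = "{v. \<forall>j. j \<notin> T \<longrightarrow> (A *v v) $ j = 0}"
  have "(*v) A ` ?U = {v. \<forall>j. j \<notin> T \<longrightarrow> v $ j = 0}"
  proof (intro equalityI subsetI)
    fix v :: "'k ^ 'n" assume v: "v \<in> {v. \<forall>j. j \<notin> T \<longrightarrow> v $ j = 0}"
    obtain B where "A ** B = mat 1" using inv by (auto simp: invertible_def)
    hence "A *v (B *v v) = v" by (simp add: matrix_vector_mul_assoc)
    thus "v \<in> (*v) A ` ?U" using v by (intro image_eqI[of _ _ "B *v v"]) auto
  qed auto
  hence "vec.dim ((*v) A ` ?U) = card T"
    by (simp only: vec_dim_coordinate_subspace)
  moreover have "vec.dim ((*v) A ` ?U) = vec.dim ?U"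
    by (intro vec.dim_image_eq matrix_vector_mul_linear_gen inj_on_subset[OF inj_matrix_vector_mult[OF inv]])
      simp
  ultimately show ?thesis by (simp only:)
qed

text \<open>A basis of \<open>W\<close> is completed by standard basis vectors.\<close>

lemma subspace_complement_matrix:
  fixes W :: "('k::field ^ 'n::finite) set"
  assumes "vec.subspace W"
  shows "\<exists>T r. (\<forall>j. j \<notin> T \<longrightarrow> r j \<in> W) \<and> W \<subseteq> vec.span (r ` (- T)) \<and>
    det (\<chi> j. if j \<in> T then axis j 1 else r j) \<noteq> 0"
proof -
  obtain B where B: "B \<subseteq> W" "vec.independent B" "W \<subseteq> vec.span B"
    using vec.basis_exists[of W] by metis
  obtain C where C: "B \<subseteq> C" "C \<subseteq> B \<union> cart_basis" "vec.independent C" "B \<union> cart_basis \<subseteq> vec.span C"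
    using vec.maximal_independent_subset_extend[of B "B \<union> cart_basis"] B by blast
  have span: "vec.span C = UNIV"
    using vec.span_mono[of cart_basis "vec.span C"] C(4) span_cart_basis
    by (auto simp: vec.span_span)
  have fin: "finite C" using C(3) by (rule vec.finiteI_independent)
  have "card C = card (cart_basis :: ('k ^ 'n) set)"
    by (metis vec.dim_eq_card C(3) span vec.span_UNIV independent_cart_basis span_cart_basis)
  hence cardC: "card C = CARD('n)" by (simp add: card_cart_basis)
  \<comment> \<open>These index the standard vectors added to \<open>B\<close>; counting leaves
    exactly \<open>card B\<close> rows to be filled from \<open>B\<close>.\<close>
  define T where "T = {k. axis k 1 \<in> C - B}"
  have "C - B = (\<lambda>k. axis k 1) ` T"
    using C(2) by (auto simp: T_def cart_basis_def)
  moreover have "inj_on (\<lambda>k. axis k (1::'k)) T"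
    by (intro inj_onI) (simp add: axis_eq_axis)
  ultimately have "card (C - B) = card T" by (simp add: card_image)
  moreover have "card (C - B) = card C - card B"
    using C(1) fin by (intro card_Diff_subset) (auto intro: finite_subset)
  moreover have "card (- T) = CARD('n) - card T"
    by (simp add: Compl_eq_Diff_UNIV card_Diff_subset)
  moreover have "card B \<le> card C" using C(1) fin by (rule card_mono[rotated])
  ultimately have "card (- T) = card B" using cardC by simp
  then obtain r where r: "bij_betw r (- T) B"
    using finite_same_card_bij[of "- T" B] C(1) fin by (auto intro: finite_subset)
  let ?A = "(\<chi> j. if j \<in> T then axis j 1 else r j) :: 'k ^ 'n ^ 'n"
  have "C \<subseteq> rows ?A"
  proof
    fix v assume "v \<in> C"
    show "v \<in> rows ?A"
    proof (cases "v \<in> B")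
      case True
      then obtain j where "j \<notin> T" "v = r j" using r by (auto simp: bij_betw_def)
      thus ?thesis by (auto simp: rows_def row_def vec_eq_iff intro!: exI[of _ j])
    next
      case False
      then obtain j where "j \<in> T" "v = axis j 1"
        using \<open>v \<in> C\<close> \<open>C - B = _\<close> by blast
      thus ?thesis by (auto simp: rows_def row_def vec_eq_iff intro!: exI[of _ j])
    qed
  qed
  hence "vec.span (rows ?A) = UNIV"
    using vec.span_mono[of C "rows ?A"] span by auto
  hence "det ?A \<noteq> 0"
    using matrix_left_invertible_span_rows_gen[of ?A] invertible_left_inverse[of ?A]
    by (simp add: invertible_det_nz)
  moreover have "r ` (- T) = B" using r by (auto simp: bij_betw_def)
  ultimately show ?thesis using B by (intro exI[of _ T] exI[of _ r]) auto
qed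

section \<open>Conormal and tangent spaces, and the prime ideal of a variety\<close>

definition gradient :: "('n::finite, 'k::field) mpoly \<Rightarrow> 'k ^ 'n \<Rightarrow> 'k ^ 'n"
  where "gradient f p = (\<chi> i. eval_mpoly (partial_deriv i f) p)"

lemma tangent_space_alt:
  "tangent_space V p = {v. \<forall>f\<in>vanishing_ideal V. (\<Sum>i\<in>UNIV. gradient f p $ i * v $ i) = 0}"
  by (simp add: tangent_space_def gradient_def)

lemma subspace_tangent_space: "vec.subspace (tangent_space V p)"
  unfolding vec.subspace_def tangent_space_def
  by (auto simp: distrib_left sum.distrib mult.left_commute simp flip: sum_distrib_left)

lemma ring_ideal_vanishing_ideal: "ring_ideal (vanishing_ideal V)"
  by unfold_locales (auto simp: vanishing_ideal_def eval_mpoly_add eval_mpoly_mult)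

lemma zero_locus_vanishing_ideal: "zariski_closed V \<Longrightarrow> zero_locus (vanishing_ideal V) = V"
  by (auto simp: zariski_closed_def zero_locus_def vanishing_ideal_def)

text \<open>These are the conormal vectors, whose annihilator is the tangent space. Scalars are
  absorbed as constant polynomials, by which the ideal may be multiplied.\<close>

lemma subspace_gradients: "vec.subspace ((\<lambda>f. gradient f p) ` vanishing_ideal V)"
proof -
  interpret ring_ideal "vanishing_ideal V" by (rule ring_ideal_vanishing_ideal)
  have add: "gradient f p + gradient g p = gradient (f + g) p" for f g
    by (simp add: gradient_def vec_eq_iff partial_deriv_add eval_mpoly_add)
  have scale: "c *s gradient f p = gradient (const_poly c * f) p" for c f
    by (simp add: gradient_def vec_eq_iff partial_deriv_mult eval_mpoly_mult)
  have zero: "0 = gradient 0 p"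
    by (simp add: gradient_def vec_eq_iff)
  show ?thesis
    unfolding vec.subspace_def
  proof (intro conjI ballI allI)
    show "0 \<in> (\<lambda>f. gradient f p) ` vanishing_ideal V"
      using zero zero_mem by blast
  qed (auto simp: add scale intro!: imageI add_mem mult_mem)
qed

lemma zariski_closed_inter_zero_locus:
  fixes V :: "('k::field ^ 'n::finite) set"
  assumes "zariski_closed V"
  shows "zariski_closed (V \<inter> {x. eval_mpoly f x = 0})"
proof -
  obtain S where "V = zero_locus S" using assms by (auto simp: zariski_closed_def)
  hence "V \<inter> {x. eval_mpoly f x = 0} = zero_locus (insert f S)" by (auto simp: zero_locus_def)
  thus ?thesis by (auto simp: zariski_closed_def)
qed

text \<open>If \<open>f * g\<close> vanishes on \<open>V\<close>, the zeros of \<open>f\<close> and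
  of \<open>g\<close> split \<open>V\<close> into two closed pieces, and irreducibility makes one of
  them all of \<open>V\<close>.\<close>

lemma mpoly_prime_vanishing_ideal:
  assumes "irreducible_affine_variety V"
  shows "mpoly_prime (vanishing_ideal V)"
proof -
  interpret ring_ideal "vanishing_ideal V" by (rule ring_ideal_vanishing_ideal)
  have V: "zariski_closed V" "V \<noteq> {}"
    and irr: "\<And>Y Z. zariski_closed Y \<Longrightarrow> zariski_closed Z \<Longrightarrow> V = Y \<union> Z \<Longrightarrow> V = Y \<or> V = Z"
    using assms by (auto simp: irreducible_affine_variety_def)
  show ?thesis
  proof
    show "1 \<notin> vanishing_ideal V" using V(2) by (auto simp: vanishing_ideal_def)
    fix f g assume "f * g \<in> vanishing_ideal V"
    hence "V = V \<inter> {x. eval_mpoly f x = 0} \<union> V \<inter> {x. eval_mpoly g x = 0}"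
      by (auto simp: vanishing_ideal_def eval_mpoly_mult)
    from irr[OF zariski_closed_inter_zero_locus[OF V(1)] zariski_closed_inter_zero_locus[OF V(1)] this]
    show "f \<in> vanishing_ideal V \<or> g \<in> vanishing_ideal V"
      by (auto simp: vanishing_ideal_def)
  qed
qed

text \<open>The set where \<open>h\<close> is nonzero is dense in \<open>V\<close>: the product
  \<open>h * f\<close> vanishes on \<open>V\<close>, and the ideal is prime.\<close>

lemma mem_vanishing_ideal_if_off_hypersurface:
  fixes V :: "('k::field ^ 'n::finite) set"
  assumes "irreducible_affine_variety V" "h \<notin> vanishing_ideal V"
    and "\<And>q. q \<in> V \<Longrightarrow> eval_mpoly h q \<noteq> 0 \<Longrightarrow> eval_mpoly f q = 0"
  shows "f \<in> vanishing_ideal V"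
proof -
  interpret mpoly_prime "vanishing_ideal V" by (rule mpoly_prime_vanishing_ideal) fact
  have "h * f \<in> vanishing_ideal V"
    using assms(3) by (auto simp: vanishing_ideal_def eval_mpoly_mult)
  thus ?thesis using prime assms(2) by blast
qed

lemma eval_mpoly_det:
  fixes A :: "('n::finite, 'k::comm_ring_1) mpoly ^ 'm::finite ^ 'm"
  shows "eval_mpoly (det A) x = det (\<chi> i j. eval_mpoly (A $ i $ j) x)"
  by (simp add: det_def eval_mpoly_sum eval_mpoly_mult eval_mpoly_prod eval_mpoly_of_int)

lemma eval_vfield: "eval_mpoly (vfield u f) q = (\<Sum>i\<in>UNIV. gradient f q $ i * eval_mpoly (u i) q)"
  by (simp add: vfield_def gradient_def eval_mpoly_sum eval_mpoly_mult mult.commute)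

text \<open>Both sides equal the dimension of the variety. Smoothness enters the construction of
  charts through this constancy.\<close>

lemma smooth_variety_dim_tangent_space:
  assumes "smooth_variety V" "p \<in> V" "q \<in> V"
  shows "vec.dim (tangent_space V p) = vec.dim (tangent_space V q)"
  using assms by (metis singular_point_def smooth_variety_def enat.inject)

text \<open>
  Gradients of finitely many equations span the conormal space at \<open>p\<close>; together with the coordinates
  in \<open>T\<close> they form a square matrix with determinant \<open>h\<close>, and \<open>w\<close> is its adjugate (Cramer's rule).
  Since the tangent spaces have constant dimension, the same equations define the tangent space
  wherever \<open>h \<noteq> 0\<close>.
\<close>

lemma smooth_chart:
  fixes V :: "('k::field ^ 'n::finite) set"
  assumes irr: "irreducible_affine_variety V" and smooth: "smooth_variety V" and p: "p \<in> V"
  shows "\<exists>T h w. eval_mpoly h p \<noteq> 0 \<and>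
    (\<forall>k\<in>T. \<forall>f\<in>vanishing_ideal V. vfield (w k) f \<in> vanishing_ideal V) \<and>
    (\<forall>k\<in>T. \<forall>l\<in>T. w k l - (if k = l then h else 0) \<in> vanishing_ideal V) \<and>
    (\<forall>u. (\<forall>f\<in>vanishing_ideal V. vfield u f \<in> vanishing_ideal V) \<and> (\<forall>k\<in>T. u k \<in> vanishing_ideal V)
      \<longrightarrow> (\<forall>i. u i \<in> vanishing_ideal V))"
proof -
  let ?P = "vanishing_ideal V"
  obtain T r where r: "\<forall>j. j \<notin> T \<longrightarrow> r j \<in> (\<lambda>f. gradient f p) ` ?P"
    "(\<lambda>f. gradient f p) ` ?P \<subseteq> vec.span (r ` (- T))"
    "det (\<chi> j. if j \<in> T then axis j 1 else r j) \<noteq> 0"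
    using subspace_complement_matrix[OF subspace_gradients[of p V]] by (elim exE conjE) (rule that)
  have "\<forall>j. \<exists>g. j \<notin> T \<longrightarrow> g \<in> ?P \<and> r j = gradient g p"
    using r(1) by blast
  then obtain g where "\<forall>j. j \<notin> T \<longrightarrow> g j \<in> ?P \<and> r j = gradient (g j) p"
    unfolding choice_iff by blast
  hence g: "\<And>j. j \<notin> T \<Longrightarrow> g j \<in> ?P" "\<And>j. j \<notin> T \<Longrightarrow> r j = gradient (g j) p"
    by auto
  define M :: "('n, 'k) mpoly ^ 'n ^ 'n"
    where "M = (\<chi> j i. if j \<in> T then (if i = j then 1 else 0) else partial_deriv i (g j))"
  define N where "N q = (\<chi> j i. eval_mpoly (M $ j $ i) q)" for q
  define h where "h = det M"
  define w where "w k i = det (\<chi> a b. if b = i then (if a = k then 1 else 0) else M $ a $ b)" for k i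
  have eval_h: "eval_mpoly h q = det (N q)" for q
    by (simp add: h_def N_def eval_mpoly_det)
  have N: "(N q *v v) $ j = (if j \<in> T then v $ j else \<Sum>i\<in>UNIV. gradient (g j) q $ i * v $ i)" for q v j
  proof (cases "j \<in> T")
    case True
    have "(N q *v v) $ j = (\<Sum>i\<in>UNIV. if i = j then v $ i else 0)"
      unfolding matrix_vector_mult_def vec_lambda_beta using True
      by (intro sum.cong) (auto simp: N_def M_def)
    thus ?thesis using True by simp
  qed (simp add: matrix_vector_mult_def N_def M_def gradient_def)
  define U where "U q = {v. \<forall>j. j \<notin> T \<longrightarrow> (N q *v v) $ j = 0}" for q
  have Usub: "vec.subspace (U q)" for q
    by (auto simp: U_def vec.subspace_def matrix_vector_right_distrib matrix_vector_mult_scaleR vec.scale)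
  have TU: "tangent_space V q \<subseteq> U q" for q
    using g(1) by (auto simp: U_def N tangent_space_alt)
  have "N p = (\<chi> j. if j \<in> T then axis j 1 else r j)"
    by (auto simp: N_def M_def vec_eq_iff axis_def g(2) gradient_def)
  hence hp: "eval_mpoly h p \<noteq> 0"
    using r(3) by (simp add: eval_h)
  \<comment> \<open>At \<open>p\<close> the chosen gradients span all conormal vectors, so a vector
    orthogonal to them is tangent.\<close>
  have "U p \<subseteq> tangent_space V p"
  proof
    fix v assume v: "v \<in> U p"
    let ?S = "{a. (\<Sum>i\<in>UNIV. a $ i * v $ i) = 0}"
    have "vec.subspace ?S"
      by (auto simp: vec.subspace_def distrib_right sum.distrib mult.assoc simp flip: sum_distrib_left)
    moreover have "r ` (- T) \<subseteq> ?S"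
      using v by (auto simp: U_def N g(2))
    ultimately have "vec.span (r ` (- T)) \<subseteq> ?S"
      by (simp add: vec.span_minimal)
    thus "v \<in> tangent_space V p"
      using r(2) by (auto simp: tangent_space_alt)
  qed
  hence "tangent_space V p = U p" using TU by blast
  hence dimp: "vec.dim (tangent_space V p) = card T"
    using vec_dim_preimage_coordinate_subspace[of "N p" T] hp by (simp add: eval_h U_def)
  \<comment> \<open>Both spaces have dimension \<open>card T\<close>, \<open>U q\<close> by
    invertibility of \<open>N q\<close> and the tangent space by comparison with \<open>p\<close>,
    so the inclusion is an equality.\<close>
  have Teq: "tangent_space V q = U q" if "q \<in> V" "eval_mpoly h q \<noteq> 0" for q
  proof -
    have "vec.dim (U q) = card T"
      using vec_dim_preimage_coordinate_subspace[of "N q" T] that by (simp add: eval_h U_def)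
    thus ?thesis
      using smooth_variety_dim_tangent_space[OF smooth p that(1)] dimp TU
      by (intro vec.subspace_dim_equal subspace_tangent_space Usub) auto
  qed
  have h: "h \<notin> ?P" using hp p by (auto simp: vanishing_ideal_def)
  note off = mem_vanishing_ideal_if_off_hypersurface[OF irr h]
  have Nw: "N q *v (\<chi> i. eval_mpoly (w k i) q) = eval_mpoly h q *s axis k 1"
    if "eval_mpoly h q \<noteq> 0" for k q
  proof -
    let ?x = "\<chi> i. det (\<chi> a b. if b = i then axis k 1 $ a else N q $ a $ b) / det (N q)"
    have "N q *v ?x = axis k 1"
      using cramer[of "N q" ?x "axis k 1"] that by (simp add: eval_h)
    moreover have "(\<chi> i. eval_mpoly (w k i) q) = eval_mpoly h q *s ?x"
      using that by (auto simp: vec_eq_iff w_def eval_mpoly_det eval_h N_def axis_def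
          intro!: arg_cong[of _ _ det])
    ultimately show ?thesis
      by (simp add: vec.scale)
  qed
  have "vfield (w k) f \<in> ?P" if k: "k \<in> T" and f: "f \<in> ?P" for k f
  proof (rule off)
    fix q assume q: "q \<in> V" "eval_mpoly h q \<noteq> 0"
    \<comment> \<open>\<open>U q\<close> is defined by the rows outside \<open>T\<close>, where a
      multiple of \<open>axis k 1\<close> with \<open>k \<in> T\<close> is zero.\<close>
    have "(\<chi> i. eval_mpoly (w k i) q) \<in> U q"
      using k by (auto simp: U_def Nw[OF q(2)] axis_def)
    hence "(\<chi> i. eval_mpoly (w k i) q) \<in> tangent_space V q"
      using Teq[OF q] by simp
    thus "eval_mpoly (vfield (w k) f) q = 0"
      using f by (auto simp: tangent_space_alt eval_vfield)
  qed
  moreover have "w k l - (if k = l then h else 0) \<in> ?P" if "k \<in> T" "l \<in> T" for k l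
  proof (rule off)
    fix q assume q: "q \<in> V" "eval_mpoly h q \<noteq> 0"
    have "(N q *v (\<chi> i. eval_mpoly (w k i) q)) $ l = eval_mpoly (w k l) q"
      using that by (simp add: N)
    thus "eval_mpoly (w k l - (if k = l then h else 0)) q = 0"
      by (auto simp: Nw[OF q(2)] axis_def eval_mpoly_diff)
  qed
  moreover have "u i \<in> ?P" if u: "\<forall>f\<in>?P. vfield u f \<in> ?P" "\<forall>k\<in>T. u k \<in> ?P" for u i
  proof (rule off)
    fix q assume q: "q \<in> V" "eval_mpoly h q \<noteq> 0"
    let ?v = "\<chi> i. eval_mpoly (u i) q"
    \<comment> \<open>Rows in \<open>T\<close> vanish because \<open>u\<close> does there, the
      others because a tangent field kills each equation \<open>g j\<close> on
      \<open>V\<close>.\<close>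
    have "N q *v ?v = 0"
    proof (rule vec_eq_iff[THEN iffD2], rule allI)
      fix j
      have "eval_mpoly (vfield u (g j)) q = 0" if "j \<notin> T"
        using u(1) g(1)[OF that] q(1) by (auto simp: vanishing_ideal_def)
      moreover have "eval_mpoly (u j) q = 0" if "j \<in> T"
        using u(2) that q(1) by (auto simp: vanishing_ideal_def)
      ultimately show "(N q *v ?v) $ j = 0 $ j"
        by (simp add: N eval_vfield)
    qed
    moreover have "invertible (N q)"
      using q(2) by (simp add: invertible_det_nz eval_h)
    ultimately have "?v = 0"
      using inj_matrix_vector_mult[of "N q"] vec.inj_iff_eq_0[of "N q"] by blast
    thus "eval_mpoly (u i) q = 0"
      by (simp add: vec_eq_iff)
  qed
  ultimately show ?thesis using hp by (intro exI[of _ T] exI[of _ h] exI[of _ w]) blast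
qed

section \<open>Stable ideals\<close>

text \<open>The algebraic content of a chart: on polynomials in the parameters indexed by
  \<open>T\<close>, the field \<open>w k\<close> acts modulo \<open>P\<close> as \<open>h\<close>
  times the \<open>k\<close>-th partial derivative, and a tangent field is determined modulo
  \<open>P\<close> by its values on the parameters.\<close>

locale tangent_chart = mpoly_prime P
  for P :: "('n::finite, 'k::field_char_0) mpoly set" +
  fixes T :: "'n set" and h :: "('n, 'k) mpoly" and w :: "'n \<Rightarrow> 'n \<Rightarrow> ('n, 'k) mpoly"
  assumes frame_tangent: "k \<in> T \<Longrightarrow> f \<in> P \<Longrightarrow> vfield (w k) f \<in> P"
    and frame_coordinates: "k \<in> T \<Longrightarrow> l \<in> T \<Longrightarrow> w k l - (if k = l then h else 0) \<in> P"
    and tangent_determined: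
      "(\<And>f. f \<in> P \<Longrightarrow> vfield u f \<in> P) \<Longrightarrow> (\<And>k. k \<in> T \<Longrightarrow> u k \<in> P) \<Longrightarrow> u i \<in> P"
begin

text \<open>
  Otherwise \<open>\<partial>/\<partial>x\<^sub>j\<close>, which kills the variables in \<open>T\<close>, would extend to a tangent field up to a factor.
\<close>

lemma var_algebraic: "sub.algebraic_mod T (mpoly_var j)"
proof (rule ccontr)
  let ?X = "mpoly_var j :: ('n, 'k) mpoly"
  assume na: "\<not> sub.algebraic_mod T ?X"
  have "j \<notin> T"
  proof
    assume j: "j \<in> T"
    \<comment> \<open>A variable in \<open>T\<close> is the root of a linear polynomial over the
      subring.\<close>
    let ?q = "Polynomial.monom 1 1 - Polynomial.monom ?X 0"
    have "?q \<in> mpolys_in.polys T"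
      using j by (intro mpolys_in.polys_diff mpolys_in.polys_monom mpolys_in.one_closed var_mpolys_in)
    moreover have "poly ?q ?X \<in> P" by (simp add: poly_monom zero_mem)
    moreover have "coeff ?q 1 \<notin> P" using one_notin by simp
    ultimately show False using na not_algebraic_coeffs_mem by blast
  qed
  define e :: "'n \<Rightarrow> ('n, 'k) mpoly" where "e i = (if i = j then 1 else 0)" for i
  have e0: "vfield e g = 0" if "g \<in> mpolys_in T" for g
  proof -
    have "vfield e g = 0 * vfield e g"
      using \<open>j \<notin> T\<close> by (intro vfield_scaled[OF that]) (auto simp: e_def)
    thus ?thesis by simp
  qed
  \<comment> \<open>By transcendence every coefficient of such a \<open>g\<close> lies in
    \<open>P\<close>, and hence so do those of its formal derivative.\<close>
  have "vfield e g \<in> P" if g: "g \<in> P \<inter> mpolys_in (insert j T)" for g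
  proof -
    obtain r where r: "r \<in> mpolys_in.polys T" "g = poly r ?X"
      using mpolys_in_insert g by blast
    hence rP: "coeff r k \<in> P" for k
      using not_algebraic_coeffs_mem[OF na r(1)] g by auto
    have "map_poly (vfield e) r = 0"
      using r(1) by (intro poly_eqI) (simp add: coeff_map_poly vfield.zero e0 mpolys_in.coeff_polys)
    moreover have "coeff (formal_deriv r) k \<in> P" for k
      unfolding coeff_formal_deriv by (intro mult_mem rP)
    ultimately show ?thesis
      unfolding r(2) vfield.poly by (auto intro!: mult_mem_right poly_mem)
  qed
  then obtain c u where u: "c \<notin> P" "\<forall>s\<in>insert j T. u s = c * e s" "\<forall>g\<in>P. vfield u g \<in> P"
    using vfield_extension[OF mpoly_prime_axioms, of "insert j T" e] by blast
  \<comment> \<open>The extended field vanishes on \<open>T\<close>, so its value at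
    \<open>j\<close> must lie in \<open>P\<close>; but that value is \<open>c\<close>.\<close>
  have "u j \<in> P"
  proof (rule tangent_determined)
    show "u k \<in> P" if "k \<in> T" for k
    proof -
      have "u k = 0" using u(2) that \<open>j \<notin> T\<close> by (auto simp: e_def)
      thus ?thesis by (simp add: zero_mem)
    qed
  qed (use u(3) in blast)
  thus False using u by (simp add: e_def)
qed

text \<open>The variables outside \<open>T\<close> are eliminated one by one, since each is
  algebraic. Thus an ideal strictly above \<open>P\<close> contains a polynomial in the parameters
  that is outside \<open>P\<close>.\<close>

lemma ex_multiple_mpolys_in:
  assumes "f \<notin> P"
  shows "\<exists>u. \<exists>b\<in>mpolys_in T. b \<notin> P \<and> u * f - b \<in> P"
proof -
  have "\<exists>u. \<exists>b\<in>mpolys_in T. b \<notin> P \<and> u * f - b \<in> P"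
    if "f \<in> mpolys_in (T \<union> U)" "f \<notin> P" for f U
    using finite[of U] that
  proof (induction U arbitrary: f rule: finite_induct)
    case empty
    thus ?case by (intro exI[of _ 1] bexI[of _ f]) (auto simp: zero_mem)
  next
    case (insert i U)
    let ?X = "mpoly_var i :: ('n, 'k) mpoly"
    have "mpolys_in.polys T \<subseteq> mpolys_in.polys (T \<union> U)"
      using mpolys_in_mono[of T "T \<union> U"] by (auto simp: mpolys_in.polys_def)
    hence alg: "sub.algebraic_mod (T \<union> U) ?X"
      using var_algebraic[of i] unfolding sub.algebraic_mod_def by blast
    obtain q where q: "q \<in> mpolys_in.polys (T \<union> U)" "f = poly q ?X"
      using mpolys_in_insert[of f i "T \<union> U"] insert.prems by auto
    obtain u b where u: "b \<in> mpolys_in (T \<union> U)" "b \<notin> P" "poly u ?X * f - b \<in> P"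
      using sub.algebraic_multiple_in_subring[OF alg q(1)] q(2) insert.prems by blast
    obtain v b' where v: "b' \<in> mpolys_in T" "b' \<notin> P" "v * b - b' \<in> P"
      using insert.IH[OF u(1,2)] by blast
    have "v * poly u ?X * f - b' = v * (poly u ?X * f - b) + (v * b - b')"
      by (simp add: algebra_simps)
    also have "\<dots> \<in> P" using u v by (intro add_mem mult_mem)
    finally show ?case using v by blast
  qed
  from this[of f UNIV] show ?thesis using assms by (simp add: mpolys_in_UNIV)
qed

end

section \<open>Differentiating a polynomial down to a nonzero constant\<close>

lemma keys_partial_deriv_subset:
  "Poly_Mapping.keys (partial_deriv i f) \<subseteq>
    (\<lambda>m. m - Poly_Mapping.single i 1) ` {m \<in> Poly_Mapping.keys f. Poly_Mapping.lookup m i \<noteq> 0}"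
  unfolding partial_deriv_def
proof (intro order.trans[OF keys_sum] UN_least)
  fix m assume "m \<in> Poly_Mapping.keys f"
  thus "Poly_Mapping.keys (Poly_Mapping.single (m - Poly_Mapping.single i 1)
      (of_nat (Poly_Mapping.lookup m i) * Poly_Mapping.lookup f m)) \<subseteq>
    (\<lambda>m. m - Poly_Mapping.single i 1) ` {m \<in> Poly_Mapping.keys f. Poly_Mapping.lookup m i \<noteq> 0}"
    by (cases "Poly_Mapping.lookup m i = 0") auto
qed

text \<open>Monomials with positive exponent at \<open>i\<close> stay distinct when that exponent
  drops by one, so no terms merge; those with exponent 0 contribute nothing.\<close>

lemma lookup_partial_deriv:
  assumes "Poly_Mapping.lookup m i \<noteq> 0"
  shows "Poly_Mapping.lookup (partial_deriv i f) (m - Poly_Mapping.single i 1) =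
    of_nat (Poly_Mapping.lookup m i) * Poly_Mapping.lookup f m"
proof -
  have inj: "m' = m" if "m' - Poly_Mapping.single i 1 = m - Poly_Mapping.single i 1"
    "Poly_Mapping.lookup m' i \<noteq> 0" for m'
  proof (rule poly_mapping_eqI)
    fix j
    have "Poly_Mapping.lookup (m' - Poly_Mapping.single i 1) j = Poly_Mapping.lookup (m - Poly_Mapping.single i 1) j"
      using that(1) by simp
    thus "Poly_Mapping.lookup m' j = Poly_Mapping.lookup m j"
      using that(2) assms by (cases "j = i") (auto simp: lookup_minus lookup_single)
  qed
  have "Poly_Mapping.lookup (partial_deriv i f) (m - Poly_Mapping.single i 1) =
    (\<Sum>m'\<in>Poly_Mapping.keys f. if m' = m then of_nat (Poly_Mapping.lookup m i) * Poly_Mapping.lookup f m else 0)"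
    unfolding partial_deriv_def lookup_sum
  proof (intro sum.cong refl)
    fix m'
    show "Poly_Mapping.lookup (Poly_Mapping.single (m' - Poly_Mapping.single i 1)
        (of_nat (Poly_Mapping.lookup m' i) * Poly_Mapping.lookup f m')) (m - Poly_Mapping.single i 1) =
      (if m' = m then of_nat (Poly_Mapping.lookup m i) * Poly_Mapping.lookup f m else 0)"
      using inj[of m'] by (cases "Poly_Mapping.lookup m' i = 0") (auto simp: lookup_single when_def)
  qed
  thus ?thesis by (auto simp: in_keys_iff)
qed

text \<open>Induction on a bound for the total degree: a nonzero partial derivative has smaller
  degree.\<close>

lemma ex_const_of_partial_deriv_closed:
  fixes J :: "('n::finite, 'k::field_char_0) mpoly set"
  assumes J: "\<And>g k. k \<in> T \<Longrightarrow> g \<in> J \<Longrightarrow> g \<in> mpolys_in T \<Longrightarrow> partial_deriv k g \<in> J"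
    and g: "g \<in> J" "g \<in> mpolys_in T" "g \<noteq> 0"
  shows "\<exists>c. c \<noteq> 0 \<and> const_poly c \<in> J"
proof -
  let ?deg = "\<lambda>m :: 'n \<Rightarrow>\<^sub>0 nat. \<Sum>i\<in>UNIV. Poly_Mapping.lookup m i"
  have "\<exists>c. c \<noteq> 0 \<and> const_poly c \<in> J"
    if "g \<in> J" "g \<in> mpolys_in T" "g \<noteq> 0" "\<forall>m\<in>Poly_Mapping.keys g. ?deg m \<le> d" for g d
    using that
  proof (induction d arbitrary: g)
    case 0
    hence "m = 0" if "m \<in> Poly_Mapping.keys g" for m
      using that by (intro poly_mapping_eqI) auto
    hence "g \<in> mpolys_in {}"
      by (auto simp: mpolys_in_def)
    hence "g = const_poly (Poly_Mapping.lookup g 0)"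
      by (rule mpolys_in_empty)
    thus ?case using 0 by (metis single_zero)
  next
    case (Suc d)
    show ?case
    proof (cases "\<exists>k\<in>T. partial_deriv k g \<noteq> 0")
      case True
      then obtain k where k: "k \<in> T" "partial_deriv k g \<noteq> 0" by blast
      have "?deg m \<le> d" if "m \<in> Poly_Mapping.keys (partial_deriv k g)" for m
      proof -
        note mk = subsetD[OF keys_partial_deriv_subset that]
        obtain m' where m': "m = m' - Poly_Mapping.single k 1" "m' \<in> Poly_Mapping.keys g"
          "Poly_Mapping.lookup m' k \<noteq> 0"
          using mk by (elim imageE) auto
        have "?deg m < ?deg m'"
          using m'(3) by (intro sum_strict_mono_ex1)
            (auto simp: m'(1) lookup_minus lookup_single when_def intro!: exI[of _ k])
        thus ?thesis using Suc.prems(4) m'(2) by fastforce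
      qed
      thus ?thesis
        using Suc.IH[of "partial_deriv k g"] J[OF k(1) Suc.prems(1,2)] k(2)
          partial_deriv_mpolys_in[OF Suc.prems(2)] by blast
    next
      case False
      \<comment> \<open>All partial derivatives in \<open>T\<close> vanish, so in characteristic 0
        no monomial of \<open>g\<close> can contain a variable.\<close>
      have "m = 0" if m: "m \<in> Poly_Mapping.keys g" for m
      proof (rule poly_mapping_eqI)
        fix i
        show "Poly_Mapping.lookup m i = Poly_Mapping.lookup 0 i"
        proof (rule ccontr)
          assume i: "Poly_Mapping.lookup m i \<noteq> Poly_Mapping.lookup 0 i"
          hence "i \<in> Poly_Mapping.keys m" by (simp add: in_keys_iff)
          hence "i \<in> T" using m Suc.prems(2) by (auto simp: mpolys_in_def)
          thus False
            using lookup_partial_deriv[of m i g] i m False by (simp add: in_keys_iff)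
        qed
      qed
      hence "g \<in> mpolys_in {}" by (auto simp: mpolys_in_def)
      hence "g = const_poly (Poly_Mapping.lookup g 0)"
        by (rule mpolys_in_empty)
      thus ?thesis using Suc.prems by (metis single_zero)
    qed
  qed
  moreover have "\<forall>m\<in>Poly_Mapping.keys g. ?deg m \<le> (\<Sum>m\<in>Poly_Mapping.keys g. ?deg m)"
    by (intro ballI member_le_sum) auto
  ultimately show ?thesis using g by blast
qed

context tangent_chart
begin

text \<open>\<open>I\<close> contains a nonzero polynomial in the parameters; differentiating it
  down to a nonzero constant costs only powers of \<open>h\<close>.\<close>

lemma power_mem_of_stable_ideal:
  assumes "ring_ideal I" and PI: "P \<subset> I"
    and stable: "\<And>k g. k \<in> T \<Longrightarrow> g \<in> I \<Longrightarrow> vfield (w k) g \<in> I"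
  shows "\<exists>N. h ^ N \<in> I"
proof -
  interpret I: ring_ideal I by fact
  obtain f where f: "f \<in> I" "f \<notin> P" using PI by blast
  obtain u b where b: "b \<in> mpolys_in T" "b \<notin> P" "u * f - b \<in> P"
    using ex_multiple_mpolys_in[OF f(2)] by blast
  have "u * f - (u * f - b) \<in> I"
    using I.diff_mem[OF I.mult_mem[OF f(1)], of "u * f - b" u] b(3) PI by blast
  hence bI: "b \<in> I" by simp
  \<comment> \<open>the saturation of \<open>I\<close> by \<open>h\<close>, which is closed under the \<open>\<partial>/\<partial>x\<^sub>k\<close> themselves\<close>
  define J where "J = {g. \<exists>N. h ^ N * g \<in> I}"
  have "partial_deriv k g \<in> J" if k: "k \<in> T" and g: "g \<in> J" "g \<in> mpolys_in T" for k g
  proof -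
    obtain N where N: "h ^ N * g \<in> I" using g(1) by (auto simp: J_def)
    \<comment> \<open>On polynomials in the parameters, \<open>w k\<close> agrees with
      \<open>h\<close> times the partial derivative modulo \<open>P\<close>.\<close>
    have "vfield (w k) g - h * partial_deriv k g =
      (\<Sum>l\<in>UNIV. (w k l - (if l = k then h else 0)) * partial_deriv l g)"
      by (simp add: vfield_def left_diff_distrib sum_subtractf if_distrib[where f = "\<lambda>x. x * _"] cong: if_cong)
    also have "\<dots> \<in> P"
    proof (intro sum_mem)
      fix l
      show "(w k l - (if l = k then h else 0)) * partial_deriv l g \<in> P"
        using frame_coordinates[OF k, of l] partial_deriv_eq_0[OF g(2), of l] zero_mem
        by (cases "l \<in> T") (auto intro: mult_mem_right)
    qed
    finally have *: "h ^ Suc N * (vfield (w k) g - h * partial_deriv k g) \<in> I"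
      using PI by (intro I.mult_mem) auto
    have "vfield (w k) (h ^ N * g) \<in> I" using stable[OF k N] .
    hence "h * vfield (w k) (h ^ N * g) \<in> I" by (rule I.mult_mem)
    \<comment> \<open>The extra factor \<open>h\<close> restores the power lost in differentiating
      \<open>h ^ N\<close>, so that \<open>h ^ N * g\<close> can be split off.\<close>
    moreover have "h * vfield (w k) (h ^ N) * g = (of_nat N * vfield (w k) h) * (h ^ N * g)"
      unfolding vfield.power by (cases N) (auto simp: algebra_simps)
    hence "h * vfield (w k) (h ^ N) * g \<in> I"
      using N by (simp add: I.mult_mem)
    ultimately have "h * vfield (w k) (h ^ N * g) - h * vfield (w k) (h ^ N) * g \<in> I"
      by (rule I.diff_mem)
    \<comment> \<open>The exponent grows by 2: one factor comes from that repair, the other from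
      \<open>w k\<close> being \<open>h\<close> times the partial derivative.\<close>
    from I.diff_mem[OF this *] have "h ^ (N + 2) * partial_deriv k g \<in> I"
      by (simp add: vfield.leibniz algebra_simps)
    thus ?thesis unfolding J_def mem_Collect_eq by (rule exI)
  qed
  moreover have "b \<in> J" using bI by (auto simp: J_def intro: exI[of _ 0])
  moreover have "b \<noteq> 0" using b(2) zero_mem by blast
  ultimately obtain c where c: "c \<noteq> 0" "const_poly c \<in> J"
    using ex_const_of_partial_deriv_closed[of T J b] b(1) by blast
  then obtain N where "h ^ N * const_poly c \<in> I" by (auto simp: J_def)
  hence "h ^ N * const_poly c * const_poly (inverse c) \<in> I" by (rule I.mult_mem_right)
  thus ?thesis using c by (auto simp: mult.assoc mult_single)
qed

end

definition tangent_field :: "('k::field ^ 'n::finite) set \<Rightarrow> ('n \<Rightarrow> ('n, 'k) mpoly) \<Rightarrow> bool"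
  where "tangent_field V u \<longleftrightarrow> (\<forall>f\<in>vanishing_ideal V. vfield u f \<in> vanishing_ideal V)"

text \<open>A strictly larger stable ideal would contain a power of \<open>h\<close>, which does not
  vanish at \<open>p\<close>.\<close>

lemma smooth_stable_ideal_eq:
  fixes V :: "('k::field_char_0 ^ 'n::finite) set"
  assumes irr: "irreducible_affine_variety V" and smooth: "smooth_variety V" and p: "p \<in> V"
    and I: "ring_ideal I" "vanishing_ideal V \<subseteq> I" "\<And>g. g \<in> I \<Longrightarrow> eval_mpoly g p = 0"
    and stable: "\<And>u g. tangent_field V u \<Longrightarrow> g \<in> I \<Longrightarrow> vfield u g \<in> I"
  shows "I = vanishing_ideal V"
proof (rule ccontr)
  assume ne: "I \<noteq> vanishing_ideal V"
  obtain T h w where h: "eval_mpoly h p \<noteq> 0"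
    and w: "\<forall>k\<in>T. \<forall>f\<in>vanishing_ideal V. vfield (w k) f \<in> vanishing_ideal V"
    and chart: "\<forall>k\<in>T. \<forall>l\<in>T. w k l - (if k = l then h else 0) \<in> vanishing_ideal V"
      "\<forall>u. (\<forall>f\<in>vanishing_ideal V. vfield u f \<in> vanishing_ideal V) \<and> (\<forall>k\<in>T. u k \<in> vanishing_ideal V)
        \<longrightarrow> (\<forall>i. u i \<in> vanishing_ideal V)"
    using smooth_chart[OF irr smooth p] by blast
  interpret tangent_chart "vanishing_ideal V" T h w
    by (intro tangent_chart.intro mpoly_prime_vanishing_ideal irr, unfold_locales) (use w chart in blast)+
  obtain N where "h ^ N \<in> I"
    using power_mem_of_stable_ideal[OF I(1)] I(2) ne stable w unfolding tangent_field_def by blast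
  thus False using I(3) h by (fastforce simp: eval_mpoly_power)
qed

text \<open>\<open>N\<close> stands for the preimage of a submodule in the polynomial ring, so the
  argument runs on polynomials instead of classes.\<close>

theorem stable_subspace_nonconstant_eq_UNIV:
  fixes V :: "('k::{alg_closed_field, field_char_0} ^ 'n::finite) set"
  assumes irr: "irreducible_affine_variety V" and smooth: "smooth_variety V"
    and N: "vanishing_ideal V \<subseteq> N" "\<And>f g. f \<in> N \<Longrightarrow> g \<in> N \<Longrightarrow> f - g \<in> N"
    and stable: "\<And>u g. tangent_field V u \<Longrightarrow> g \<in> N \<Longrightarrow> vfield u g \<in> N"
    and f: "f \<in> N" "\<And>c. f - const_poly c \<notin> vanishing_ideal V"
  shows "N = UNIV"
proof (rule ccontr)
  assume ne: "N \<noteq> UNIV"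
  interpret P: mpoly_prime "vanishing_ideal V" by (rule mpoly_prime_vanishing_ideal) fact
  have N0: "0 \<in> N" using N(1) P.zero_mem by blast
  have Nadd: "a + b \<in> N" if "a \<in> N" "b \<in> N" for a b
    using N(2)[OF that(1) N(2)[OF N0 that(2)]] by simp
  have scaled: "tangent_field V (\<lambda>i. g * u i)" "vfield (\<lambda>i. g * u i) a = g * vfield u a"
    if "tangent_field V u" for g u a
  proof -
    show eq: "vfield (\<lambda>i. g * u i) a = g * vfield u a" for a
      by (simp add: vfield_def sum_distrib_left mult.assoc)
    show "tangent_field V (\<lambda>i. g * u i)"
      using that by (auto simp: tangent_field_def eq P.mult_mem)
  qed
  \<comment> \<open>The largest ideal contained in \<open>N\<close>.\<close>
  define I where "I = {a. \<forall>g. g * a \<in> N}"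
  have I: "ring_ideal I"
    by unfold_locales (auto simp: I_def N0 distrib_left Nadd simp flip: mult.assoc)
  have PI: "vanishing_ideal V \<subseteq> I"
    using N(1) P.mult_mem by (auto simp: I_def)
  have stableI: "vfield u a \<in> I" if u: "tangent_field V u" and a: "a \<in> I" for u a
  proof -
    have "g * vfield u a \<in> N" for g
    proof -
      \<comment> \<open>By the Leibniz rule this difference is
        \<open>g * vfield u a\<close>.\<close>
      have "vfield u (g * a) - vfield u g * a \<in> N"
        using a stable[OF u] by (intro N(2)) (auto simp: I_def)
      thus ?thesis by (simp add: vfield.leibniz)
    qed
    thus ?thesis by (simp add: I_def)
  qed
  have "1 \<notin> I" using ne by (auto simp: I_def)
  then obtain p where p: "\<forall>g\<in>I. eval_mpoly g p = 0"
    using weak_nullstellensatz[OF I] by blast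
  hence "p \<in> zero_locus (vanishing_ideal V)"
    using PI by (auto simp: zero_locus_def)
  hence pV: "p \<in> V"
    using irr zero_locus_vanishing_ideal by (auto simp: irreducible_affine_variety_def)
  have "I = vanishing_ideal V"
    using p by (intro smooth_stable_ideal_eq[OF irr smooth pV I PI] stableI) auto
  \<comment> \<open>Multiplying \<open>u\<close> by \<open>g\<close> gives another tangent field, so
    every \<open>g * vfield u f\<close> lies in \<open>N\<close>.\<close>
  moreover have "vfield u f \<in> I" if "tangent_field V u" for u
    using scaled[OF that] stable[OF scaled(1)[OF that] f(1)] by (auto simp: I_def)
  ultimately have fP: "vfield u f \<in> vanishing_ideal V" if "tangent_field V u" for u
    using that by blast
  let ?f = "f - const_poly (eval_mpoly f p)"
  \<comment> \<open>The second stable ideal, generated over the vanishing ideal by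
    \<open>?f\<close>; it is stable because tangent fields send \<open>f\<close> into the vanishing
    ideal, and it vanishes at \<open>p\<close> by the choice of constant.\<close>
  define I' where "I' = {a + g * ?f | a g. a \<in> vanishing_ideal V}"
  have I'I: "a + g * ?f \<in> I'" if "a \<in> vanishing_ideal V" for a g
    using that by (auto simp: I'_def)
  have "ring_ideal I'"
  proof
    show "0 \<in> I'" using I'I[OF P.zero_mem, of 0] by simp
  next
    fix x y assume "x \<in> I'" "y \<in> I'"
    then obtain a g b g' where *: "x = a + g * ?f" "y = b + g' * ?f"
      "a \<in> vanishing_ideal V" "b \<in> vanishing_ideal V" unfolding I'_def by blast
    have "x + y = (a + b) + (g + g') * ?f" unfolding * by (simp add: algebra_simps)
    thus "x + y \<in> I'" using I'I[OF P.add_mem] * by metis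
  next
    fix x y assume "y \<in> I'"
    then obtain a g where *: "y = a + g * ?f" "a \<in> vanishing_ideal V" unfolding I'_def by blast
    have "x * y = x * a + (x * g) * ?f" unfolding * by (simp add: algebra_simps)
    thus "x * y \<in> I'" using I'I[OF P.mult_mem] * by metis
  qed
  moreover have "vanishing_ideal V \<subseteq> I'"
    using I'I[of _ 0] by auto
  moreover have "eval_mpoly g p = 0" if "g \<in> I'" for g
    using that pV by (auto simp: I'_def eval_mpoly_add eval_mpoly_mult eval_mpoly_diff vanishing_ideal_def)
  moreover have "vfield u x \<in> I'" if u: "tangent_field V u" and x: "x \<in> I'" for u x
  proof -
    obtain a g where *: "x = a + g * ?f" "a \<in> vanishing_ideal V" using x unfolding I'_def by blast
    have "vfield u x = (vfield u a + g * vfield u f) + vfield u g * ?f"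
      unfolding * vfield.add vfield.leibniz vfield.diff by simp
    moreover have "vfield u a + g * vfield u f \<in> vanishing_ideal V"
      using u * fP[OF u] by (auto simp: tangent_field_def intro: P.add_mem P.mult_mem)
    ultimately show ?thesis using I'I by metis
  qed
  ultimately have "I' = vanishing_ideal V"
    by (intro smooth_stable_ideal_eq[OF irr smooth pV]) auto
  moreover have "?f \<in> I'" using I'I[OF P.zero_mem, of 1] by simp
  ultimately show False using f(2) by blast
qed

section \<open>Submodules of the coordinate algebra\<close>

lemma
  fixes V :: "('k::field ^ 'n::finite) set"
  shows carrier_coordinate_algebra: "carrier (coordinate_algebra V) = range (function_class V)"
    and function_class_add: "function_class V f \<oplus>\<^bsub>coordinate_algebra V\<^esub> function_class V g = function_class V (f + g)"
    and function_class_mult: "function_class V f \<otimes>\<^bsub>coordinate_algebra V\<^esub> function_class V g = function_class V (f * g)"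
    and function_class_one: "\<one>\<^bsub>coordinate_algebra V\<^esub> = function_class V 1"
    and function_class_zero: "\<zero>\<^bsub>coordinate_algebra V\<^esub> = function_class V 0"
    and function_class_smult: "c \<odot>\<^bsub>coordinate_algebra V\<^esub> function_class V f = function_class V (const_poly c * f)"
proof -
  let ?P = "polynomial_ring :: ('n, 'k) mpoly ring"
  let ?Q = "?P Quot vanishing_ideal V"
  interpret I: ideal "vanishing_ideal V" ?P by (rule ideal_vanishing_ideal)
  interpret h: ring_hom_ring ?P ?Q "(+>\<^bsub>?P\<^esub>) (vanishing_ideal V)"
    by (rule I.rcos_ring_hom_ring)
  have P: "carrier ?P = UNIV" "\<And>f g. f \<oplus>\<^bsub>?P\<^esub> g = f + g" "\<And>f g. f \<otimes>\<^bsub>?P\<^esub> g = f * g"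
    "\<one>\<^bsub>?P\<^esub> = 1" "\<zero>\<^bsub>?P\<^esub> = 0"
    by (simp_all add: ring_of_type_algebra_def)
  have Q: "function_class V (f + g) = function_class V f \<oplus>\<^bsub>?Q\<^esub> function_class V g"
    "function_class V (f * g) = function_class V f \<otimes>\<^bsub>?Q\<^esub> function_class V g"
    "function_class V 1 = \<one>\<^bsub>?Q\<^esub>" "function_class V 0 = \<zero>\<^bsub>?Q\<^esub>" for f g
    using h.hom_add[of f g] h.hom_mult[of f g] h.hom_one h.hom_zero
    by (simp_all add: function_class_def P)
  show "carrier (coordinate_algebra V) = range (function_class V)"
    by (auto simp: coordinate_algebra_def Let_def FactRing_def A_RCOSETS_def' P function_class_def)
  show "function_class V f \<oplus>\<^bsub>coordinate_algebra V\<^esub> function_class V g = function_class V (f + g)"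
    "function_class V f \<otimes>\<^bsub>coordinate_algebra V\<^esub> function_class V g = function_class V (f * g)"
    "\<one>\<^bsub>coordinate_algebra V\<^esub> = function_class V 1"
    "\<zero>\<^bsub>coordinate_algebra V\<^esub> = function_class V 0"
    "c \<odot>\<^bsub>coordinate_algebra V\<^esub> function_class V f = function_class V (const_poly c * f)"
    by (simp_all only: Q) (simp_all add: coordinate_algebra_def Let_def)
qed

lemma function_class_eq_iff:
  "function_class V f = function_class V g \<longleftrightarrow> f - g \<in> vanishing_ideal V"
proof -
  interpret ring_ideal "vanishing_ideal V" by (rule ring_ideal_vanishing_ideal)
  have *: "function_class V f = {a + f | a. a \<in> vanishing_ideal V}" for f
    by (auto simp: function_class_def a_r_coset_def' ring_of_type_algebra_def)
  show ?thesis
  proof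
    assume "function_class V f = function_class V g"
    moreover have "f \<in> function_class V f" using zero_mem by (force simp: *)
    ultimately obtain a where "f = a + g" "a \<in> vanishing_ideal V" by (auto simp: *)
    thus "f - g \<in> vanishing_ideal V" by simp
  next
    assume d: "f - g \<in> vanishing_ideal V"
    have "\<exists>b. a + f = b + g \<and> b \<in> vanishing_ideal V" if "a \<in> vanishing_ideal V" for a
      using add_mem[OF that d] by (intro exI[of _ "a + (f - g)"]) simp
    moreover have "\<exists>b. a + g = b + f \<and> b \<in> vanishing_ideal V" if "a \<in> vanishing_ideal V" for a
      using diff_mem[OF that d] by (intro exI[of _ "a - (f - g)"]) simp
    ultimately show "function_class V f = function_class V g" by (fastforce simp: *)
  qed
qed

lemma function_class_uminus:
  fixes V :: "('k::field ^ 'n::finite) set"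
  shows "\<ominus>\<^bsub>coordinate_algebra V\<^esub> function_class V f = function_class V (- f)"
proof -
  interpret A: algebra "ground_field :: 'k ring" "coordinate_algebra V" by (rule algebra_coordinate_algebra)
  show ?thesis
    by (rule A.M.minus_equality)
      (simp_all add: carrier_coordinate_algebra function_class_add function_class_zero)
qed

section \<open>Derivations of the coordinate algebra induced by tangent fields\<close>

definition induced_derivation ::
  "('k::field ^ 'n::finite) set \<Rightarrow> ('n \<Rightarrow> ('n, 'k) mpoly) \<Rightarrow> ('n, 'k) mpoly set \<Rightarrow> ('n, 'k) mpoly set"
  where "induced_derivation V u =
    (\<lambda>a\<in>carrier (coordinate_algebra V). function_class V (vfield u (SOME f. function_class V f = a)))"

text \<open>Two representatives differ by an element of the vanishing ideal, which a tangent field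
  preserves, so the choice in the definition does not matter.\<close>

lemma induced_derivation_function_class:
  assumes "tangent_field V u"
  shows "induced_derivation V u (function_class V f) = function_class V (vfield u f)"
proof -
  let ?g = "SOME g. function_class V g = function_class V f"
  have "function_class V ?g = function_class V f"
    by (rule someI[where P = "\<lambda>g. function_class V g = function_class V f"]) simp
  hence "vfield u (?g - f) \<in> vanishing_ideal V"
    using assms by (simp add: function_class_eq_iff tangent_field_def)
  thus ?thesis
    by (auto simp: induced_derivation_def carrier_coordinate_algebra function_class_eq_iff vfield.diff)
qed

lemma carrier_vector_fields: "carrier (vector_fields V) = derivations ground_field (coordinate_algebra V)"
  by (simp add: vector_fields_def derivation_algebra_def)

lemma induced_derivation_vector_field:
  fixes V :: "('k::field ^ 'n::finite) set"
  assumes "tangent_field V u"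
  shows "induced_derivation V u \<in> carrier (vector_fields V)"
  unfolding carrier_vector_fields mem_derivations_iff
proof (intro conjI ballI)
  show "induced_derivation V u \<in> carrier (coordinate_algebra V) \<rightarrow>\<^sub>E carrier (coordinate_algebra V)"
    by (auto simp: induced_derivation_def carrier_coordinate_algebra)
qed (auto simp: carrier_coordinate_algebra function_class_add function_class_mult function_class_smult
    induced_derivation_function_class[OF assms] vfield.add vfield.leibniz)

text \<open>The preimage of \<open>N\<close> under \<open>function_class\<close> is stable under
  tangent fields, as these induce derivations, so the result for polynomials applies.\<close>

lemma vector_field_submodule_eq_carrier:
  fixes V :: "('k::{alg_closed_field, field_char_0} ^ 'n::finite) set"
  assumes irr: "irreducible_affine_variety V" and smooth: "smooth_variety V"
    and N: "vector_field_submodule V N" and nonconst: "\<not> N \<subseteq> constant_functions V"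
  shows "N = carrier (coordinate_algebra V)"
proof -
  let ?A = "coordinate_algebra V"
  interpret A: algebra "ground_field :: 'k ring" ?A by (rule algebra_coordinate_algebra)
  interpret I: ring_ideal "vanishing_ideal V" by (rule ring_ideal_vanishing_ideal)
  have sub: "submodule N ground_field ?A" and act: "\<And>D v. D \<in> carrier (vector_fields V) \<Longrightarrow> v \<in> N \<Longrightarrow> D v \<in> N"
    using N by (auto simp: vector_field_submodule_def lie_submodule_def)
  note subE = A.submoduleE[OF sub]
  have N0: "function_class V 0 \<in> N"
    using subgroup.one_closed[OF submodule.axioms(1)[OF sub]] by (simp add: function_class_zero)
  obtain f where f: "function_class V f \<in> N" "function_class V f \<notin> constant_functions V"
    using subE(1) nonconst by (auto simp: carrier_coordinate_algebra)
  have "{g. function_class V g \<in> N} = UNIV"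
  proof (rule stable_subspace_nonconstant_eq_UNIV[OF irr smooth])
    show "vanishing_ideal V \<subseteq> {g. function_class V g \<in> N}"
    proof
      fix g assume "g \<in> vanishing_ideal V"
      hence "function_class V g = function_class V 0" by (simp add: function_class_eq_iff)
      thus "g \<in> {g. function_class V g \<in> N}" using N0 by simp
    qed
    show "a - b \<in> {g. function_class V g \<in> N}"
      if "a \<in> {g. function_class V g \<in> N}" "b \<in> {g. function_class V g \<in> N}" for a b
      using subE(5)[of "function_class V a" "function_class V (- b)"] subE(3)[of "function_class V b"] that
      by (simp add: function_class_uminus function_class_add)
    show "vfield u g \<in> {g. function_class V g \<in> N}"
      if "tangent_field V u" "g \<in> {g. function_class V g \<in> N}" for u g
      using act[OF induced_derivation_vector_field[OF that(1)]] that
      by (metis induced_derivation_function_class mem_Collect_eq)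
    show "f \<in> {g. function_class V g \<in> N}" using f by simp
    show "f - const_poly c \<notin> vanishing_ideal V" for c
      using f(2) by (auto simp: constant_functions_def simp flip: function_class_eq_iff)
  qed
  thus ?thesis using subE(1) by (auto simp: carrier_coordinate_algebra)
qed

section \<open>The submodule of constant functions\<close>

lemma constant_functions_eq_if_nonzero:
  fixes V :: "('k::field ^ 'n::finite) set"
  assumes N: "vector_field_submodule V N" "N \<noteq> {\<zero>\<^bsub>coordinate_algebra V\<^esub>}"
    and const: "N \<subseteq> constant_functions V"
  shows "N = constant_functions V"
proof -
  let ?A = "coordinate_algebra V"
  interpret A: algebra "ground_field :: 'k ring" ?A by (rule algebra_coordinate_algebra)
  have sub: "submodule N ground_field ?A"
    using N by (auto simp: vector_field_submodule_def lie_submodule_def)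
  have "\<zero>\<^bsub>?A\<^esub> \<in> N"
    using subgroup.one_closed[OF submodule.axioms(1)[OF sub]] by simp
  then obtain a where "a \<in> N" "a \<noteq> \<zero>\<^bsub>?A\<^esub>" using N(2) by blast
  moreover from this obtain c where "a = function_class V (const_poly c)"
    using const by (auto simp: constant_functions_def)
  ultimately have c: "function_class V (const_poly c) \<in> N" "c \<noteq> 0"
    by (auto simp: function_class_zero)
  \<comment> \<open>Rescaling one nonzero constant by \<open>d / c\<close> reaches every
    other.\<close>
  have "function_class V (const_poly d) \<in> N" for d
    using submodule.smult_closed[OF sub, of "d / c" "function_class V (const_poly c)"] c
    by (simp add: function_class_smult mult_single ring_of_type_algebra_def)
  thus ?thesis using const by (auto simp: constant_functions_def)
qed

text \<open>Applying \<open>D\<close> to \<open>1 * 1\<close> gives \<open>D 1 = D 1 + D 1\<close>,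
  so \<open>D 1\<close> is zero, and linearity does the rest.\<close>

lemma vector_field_const:
  fixes V :: "('k::field ^ 'n::finite) set"
  assumes D: "D \<in> carrier (vector_fields V)"
  shows "D (function_class V (const_poly c)) = \<zero>\<^bsub>coordinate_algebra V\<^esub>"
proof -
  let ?A = "coordinate_algebra V"
  interpret A: algebra "ground_field :: 'k ring" ?A by (rule algebra_coordinate_algebra)
  have fc: "function_class V f \<in> carrier ?A" for f by (simp add: carrier_coordinate_algebra)
  have D': "D \<in> carrier ?A \<rightarrow>\<^sub>E carrier ?A"
    "\<And>c a. a \<in> carrier ?A \<Longrightarrow> D (c \<odot>\<^bsub>?A\<^esub> a) = c \<odot>\<^bsub>?A\<^esub> D a"
    "\<And>a b. a \<in> carrier ?A \<Longrightarrow> b \<in> carrier ?A \<Longrightarrow> D (a \<otimes>\<^bsub>?A\<^esub> b) = D a \<otimes>\<^bsub>?A\<^esub> b \<oplus>\<^bsub>?A\<^esub> a \<otimes>\<^bsub>?A\<^esub> D b"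
    using D by (auto simp: carrier_vector_fields mem_derivations_iff ring_of_type_algebra_def)
  have "D (function_class V 1) \<in> carrier ?A" using D'(1) fc by blast
  then obtain g where g: "D (function_class V 1) = function_class V g"
    by (auto simp: carrier_coordinate_algebra)
  have "function_class V g = function_class V (g + g)"
    using D'(3)[OF fc fc, of 1 1] by (simp add: function_class_mult function_class_add g)
  hence "g \<in> vanishing_ideal V"
    using ring_ideal.uminus_mem[OF ring_ideal_vanishing_ideal, of "- g"] by (simp add: function_class_eq_iff)
  hence "D (function_class V 1) = function_class V 0"
    by (simp add: g function_class_eq_iff)
  thus ?thesis
    using D'(2)[OF fc, of c 1] by (simp add: function_class_smult function_class_zero)
qed

lemma vector_field_submodule_constant_functions:
  fixes V :: "('k::field ^ 'n::finite) set"
  shows "vector_field_submodule V (constant_functions V)"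
proof -
  let ?A = "coordinate_algebra V"
  interpret A: algebra "ground_field :: 'k ring" ?A by (rule algebra_coordinate_algebra)
  have c: "function_class V (const_poly c) \<in> constant_functions V" for c
    by (auto simp: constant_functions_def)
  show ?thesis
    unfolding vector_field_submodule_def lie_submodule_def
  proof (intro conjI ballI A.submoduleI)
    show "constant_functions V \<subseteq> carrier ?A"
      by (auto simp: constant_functions_def carrier_coordinate_algebra)
    show "\<zero>\<^bsub>?A\<^esub> \<in> constant_functions V"
      using c[of 0] by (simp add: function_class_zero)
    show "\<ominus>\<^bsub>?A\<^esub> a \<in> constant_functions V" if "a \<in> constant_functions V" for a
      using that c by (auto simp: constant_functions_def function_class_uminus simp flip: single_uminus)
    show "a \<oplus>\<^bsub>?A\<^esub> b \<in> constant_functions V" if "a \<in> constant_functions V" "b \<in> constant_functions V" for a b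
      using that c by (auto simp: constant_functions_def function_class_add simp flip: single_add)
    show "d \<odot>\<^bsub>?A\<^esub> a \<in> constant_functions V" if "a \<in> constant_functions V" for d a
      using that c by (auto simp: constant_functions_def function_class_smult mult_single)
    show "D a \<in> constant_functions V" if "D \<in> carrier (vector_fields V)" "a \<in> constant_functions V" for D a
      using that vector_field_const[OF that(1)] c[of 0]
      by (auto simp: constant_functions_def[of V] function_class_zero)
  qed
qed

text \<open>The copy of the base field inside the algebra is the set of constant functions itself,
  hence the line through \<open>1\<close>; \<open>1\<close> is nonzero because \<open>V\<close> has
  a point.\<close>

lemma has_dimension_constant_functions:
  fixes V :: "('k::field ^ 'n::finite) set"
  assumes "V \<noteq> {}"
  shows "has_dimension (ground_field :: 'k ring) (coordinate_algebra V) 1 (constant_functions V)"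
proof -
  let ?A = "coordinate_algebra V"
  interpret A: algebra "ground_field :: 'k ring" ?A by (rule algebra_coordinate_algebra)
  have ring: "ring ?A" by unfold_locales
  have K: "(\<lambda>c. c \<odot>\<^bsub>?A\<^esub> \<one>\<^bsub>?A\<^esub>) ` carrier (ground_field :: 'k ring) = constant_functions V"
    by (auto simp: ring_of_type_algebra_def function_class_one function_class_smult constant_functions_def)
  have "ring.line_extension ?A (constant_functions V) \<one>\<^bsub>?A\<^esub> {\<zero>\<^bsub>?A\<^esub>} = constant_functions V"
    by (auto simp: ring.line_extension_def[OF ring] set_add_def' r_coset_def constant_functions_def
        function_class_one function_class_zero function_class_mult function_class_add)
  moreover have "\<one>\<^bsub>?A\<^esub> \<notin> {\<zero>\<^bsub>?A\<^esub>}"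
    using assms by (auto simp: function_class_one function_class_zero function_class_eq_iff vanishing_ideal_def)
  ultimately have "ring.dimension ?A (Suc 0) (constant_functions V) (constant_functions V)"
    using ring.Suc_dim[OF ring ring.ring_simprules(6)[OF ring] _ ring.zero_dim[OF ring], of "constant_functions V"] by simp
  thus ?thesis unfolding has_dimension_def K by simp
qed

text \<open>If all functions were constant, so would be the coordinates, and \<open>V\<close> would
  have at most one point.\<close>

lemma constant_functions_neq_carrier:
  fixes V :: "('k::field ^ 'n::finite) set"
  assumes "V \<noteq> {}" "\<nexists>p. V = {p}"
  shows "constant_functions V \<noteq> carrier (coordinate_algebra V)"
proof
  assume eq: "constant_functions V = carrier (coordinate_algebra V)"
  have "\<exists>c. \<forall>x\<in>V. x $ i = c" for i
  proof -
    have "function_class V (mpoly_var i) \<in> constant_functions V"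
      by (simp add: eq carrier_coordinate_algebra)
    then obtain c where "mpoly_var i - const_poly c \<in> vanishing_ideal V"
      by (auto simp: constant_functions_def function_class_eq_iff)
    thus ?thesis by (intro exI[of _ c]) (auto simp: vanishing_ideal_def eval_mpoly_diff)
  qed
  hence "x = y" if "x \<in> V" "y \<in> V" for x y
    using that by (metis vec_eq_iff)
  thus False using assms by blast
qed

text \<open>On a single point every function is constant, so the constants are not a proper
  submodule; this is why points are excluded.\<close>

theorem theorem4p1:
  fixes V :: "('k::{alg_closed_field, field_char_0} ^ 'n::finite) set"
  assumes variety: "irreducible_affine_variety V"
    and smooth: "smooth_variety V"
    and not_point: "\<nexists>p. V = {p}"
  shows "(\<exists>!N. vector_field_submodule V N \<and>
              N \<noteq> {\<zero>\<^bsub>coordinate_algebra V\<^esub>} \<and> N \<noteq> carrier (coordinate_algebra V)) \<and>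
         (\<forall>N. vector_field_submodule V N \<and>
              N \<noteq> {\<zero>\<^bsub>coordinate_algebra V\<^esub>} \<and> N \<noteq> carrier (coordinate_algebra V) \<longrightarrow>
              has_dimension (ground_field :: 'k ring) (coordinate_algebra V) 1 N \<and>
              N = constant_functions V)"
proof -
  have V: "V \<noteq> {}" using variety by (simp add: irreducible_affine_variety_def)
  have uniq: "N = constant_functions V"
    if "vector_field_submodule V N" "N \<noteq> {\<zero>\<^bsub>coordinate_algebra V\<^esub>}" "N \<noteq> carrier (coordinate_algebra V)" for N
    using that constant_functions_eq_if_nonzero vector_field_submodule_eq_carrier[OF variety smooth] by blast
  have "function_class V 1 \<in> constant_functions V"
    by (auto simp: constant_functions_def intro!: exI[of _ 1])
  moreover have "function_class V 1 \<noteq> \<zero>\<^bsub>coordinate_algebra V\<^esub>"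
    using V by (auto simp: function_class_zero function_class_eq_iff vanishing_ideal_def)
  ultimately have "constant_functions V \<noteq> {\<zero>\<^bsub>coordinate_algebra V\<^esub>}" by blast
  note proper = vector_field_submodule_constant_functions this constant_functions_neq_carrier[OF V not_point]
  show ?thesis
  proof (intro conjI ex1I[of _ "constant_functions V"] allI impI proper; elim conjE)
    fix N assume "vector_field_submodule V N" "N \<noteq> {\<zero>\<^bsub>coordinate_algebra V\<^esub>}" "N \<noteq> carrier (coordinate_algebra V)"
    thus N: "N = constant_functions V" "N = constant_functions V" by (rule uniq)+
    thus "has_dimension (ground_field :: 'k ring) (coordinate_algebra V) 1 N"
      using has_dimension_constant_functions[OF V] by simp
  qed
qed

end
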